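(* Let $k_0,k_1$ be continuous real-valued functions on $[0,1]\times[0,1]$, let $\varphi:[0,1]\to[0,1]$ be continuous, and suppose there exist numbers $M>0$ and $L_0,L_1,L_2,L_3\ge 0$ such that: (i) $f(x,u,y,v,z)$ is continuous in $\mathcal{D}_M$ and $|f(x,u,y,v,z)|\le M$ for all $(x,u,y,v,z)\in\mathcal{D}_M$; (ii) $|f(x,u_2,y_2,v_2,z_2)-f(x,u_1,y_1,v_1,z_1)|\le L_0|u_2-u_1|+L_1|y_2-y_1|+L_2|v_2-v_1|+L_3|z_2-z_1|$ for all $(x,u_i,y_i,v_i,z_i)\in\mathcal{D}_M$, $i=1,2$; (iii) $q:=(L_0+L_1+L_2K_0+L_3K_1)M_0<1$. Assume moreover that $f$ has all continuous partial derivatives up to second order in $\mathcal{D}_M$, that $k_0,k_1$ have all continuous partial derivatives up to second order in $[0,1]\times[0,1]$, and that $\varphi$ has continuous derivatives up to second order on $[0,1]$. Let $u$ be the exact solution (the unique solution in $C^4[0,1]$ with $|u(x)|\le M_0M$ on $[0,1]$) of the boundary value problem $$u^{(4)}(x)=f\Big(x,u(x),u(\varphi(x)),\int_0^1k_0(x,t)u(t)\,dt,\int_0^1k_1(x,t)u(\varphi(t))\,dt\Big),\qquad u(0)=u(1)=u''(0)=u''(1)=0.$$ Then for the approximate solution $U_m$ obtained by the discrete iterative method (defined in the context) on the uniform grid with grid size $h=1/N$ there holds, for each $m=0,1,\dots$, the estimate for the total error $$\|U_m-u\|\le M_0\,p_m\,d+O(h^2),\qquad p_m=\frac{q^m}{1-q},\quad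 d=\max_{0\le x\le1}|\psi_1(x)-\psi_0(x)|,$$ where $\|\cdot\|$ is the max-norm on the grid, and $\psi_0,\psi_1$ are the first two iterates of the continuous iterative method, given in the context.
   Context: $f=f(x,u,y,v,z)$ is a real-valued continuous function of $x\in[0,1]$ and $u,y,v,z\in\mathbb{R}$. $G(x,s)$ is the Green function of $u^{(4)}=0$ with the boundary conditions $u(0)=u''(0)=u(1)=u''(1)=0$: $$G(x,s)=\frac16\begin{cases}s(x-1)(x^2-2x+s^2),&0\le s\le x\le1,\\ x(s-1)(s^2-2s+x^2),&0\le x\le s\le1.\end{cases}$$ Constants: $$M_0=\max_{0\le x\le1}\int_0^1|G(x,s)|\,ds=\tfrac{5}{384},\quad K_0=\max_{0\le x\le1}\int_0^1|k_0(x,s)|\,ds,\quad K_1=\max_{0\le x\le1}\int_0^1|k_1(x,s)|\,ds.$$ Domain: $$\mathcal{D}_M=\{(x,u,y,v,z): 0\le x\le1,\ |u|\le M_0M,\ |y|\le M_0M,\ |v|\le M_0K_0M,\ |z|\le M_0K_1M\}.$$ Continuous iterative method: $\psi_0(x)=f(x,0,0,0,0)$ and, for $m=0,1,\dots$, $$u_m(x)=\int_0^1G(x,t)\psi_m(t)\,dt,\quad y_m(x)=\int_0^1G(\varphi(x),t)\psi_m(t)\,dt,$$ $$v_m(x)=\int_0^1k_0(x,t)u_m(t)\,dt,\quad z_m(x)=\int_0^1k_1(x,t)y_m(t)\,dt,\quad\psi_{m+1}(x)=f(x,u_m(x),y_m(x),v_m(x),z_m(x)).$$ Discrete iterative method: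 on the grid $\bar\omega_h=\{x_i=ih: h=1/N,\ i=0,\dots,N\}$, with $\rho_0=\rho_N=1/2$ and $\rho_j=1$ for $1\le j\le N-1$, set $\Psi_0(x_i)=f(x_i,0,0,0,0)$ and, for $m=0,1,\dots$ and $i=0,\dots,N$, $$U_m(x_i)=\sum_{j=0}^Nh\rho_jG(x_i,x_j)\Psi_m(x_j),\quad Y_m(x_i)=\sum_{j=0}^Nh\rho_jG(\varphi(x_i),x_j)\Psi_m(x_j),$$ $$V_m(x_i)=\sum_{j=0}^Nh\rho_jk_0(x_i,x_j)U_m(x_j),\quad Z_m(x_i)=\sum_{j=0}^Nh\rho_jk_1(x_i,x_j)Y_m(x_j),$$ $$\Psi_{m+1}(x_i)=f(x_i,U_m(x_i),Y_m(x_i),V_m(x_i),Z_m(x_i)).$$ The grid norm is $\|w\|=\max_{0\le i\le N}|w(x_i)|$. For each fixed $m$, $O(h^2)$ is understood as $h=1/N\to0$, with a constant independent of $h$.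
   Formalization: The continuous partial derivatives of f up to second order are assumed on a neighbourhood of D_M relative to [0,1]×R^4, not only in D_M; with derivatives relative to D_M alone the O(h^2) estimate can fail, since the discrete iterates may leave D_M. *)

theory Defs
  imports "HOL-Analysis.Analysis" "HOL-Library.Landau_Symbols"
begin

text \<open>
  Partial derivatives are taken along the basis vectors and relative to the set \<open>S\<close>, so that they are
  one-sided where \<open>S\<close> has a boundary (for instance at the endpoints of an interval).  The definition
  is used only for sets in which every point lies on a nondegenerate segment inside \<open>S\<close> in each
  basis direction, so the partial derivatives are unique.
\<close>

definition has_partial_on ::
    "'a::euclidean_space set \<Rightarrow> 'a \<Rightarrow> ('a \<Rightarrow> real) \<Rightarrow> ('a \<Rightarrow> real) \<Rightarrow> bool" where
  "has_partial_on S b F F' \<longleftrightarrow>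
     (\<forall>p\<in>S. ((\<lambda>t. F (p + t *\<^sub>R b)) has_real_derivative F' p) (at 0 within {t. p + t *\<^sub>R b \<in> S}))"

primrec Ck_on :: "nat \<Rightarrow> 'a::euclidean_space set \<Rightarrow> ('a \<Rightarrow> real) \<Rightarrow> bool" where
  "Ck_on 0 S F \<longleftrightarrow> continuous_on S F"
| "Ck_on (Suc k) S F \<longleftrightarrow>
     continuous_on S F \<and> (\<forall>b\<in>Basis. \<exists>F'. has_partial_on S b F F' \<and> Ck_on k S F')"

definition green :: "real \<Rightarrow> real \<Rightarrow> real" where
  "green x s = (1/6) * (if s \<le> x then s * (x - 1) * (x^2 - 2 * x + s^2)
                                   else x * (s - 1) * (s^2 - 2 * s + x^2))"

text \<open>The suprema below are over continuous functions on \<open>[0,1]\<close>, so they are maxima.\<close>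

definition M0 :: real where
  "M0 = (SUP x\<in>{0..1}. integral {0..1} (\<lambda>s. \<bar>green x s\<bar>))"

definition kernel_bound :: "(real \<times> real \<Rightarrow> real) \<Rightarrow> real" where
  "kernel_bound k = (SUP x\<in>{0..1}. integral {0..1} (\<lambda>s. \<bar>k (x, s)\<bar>))"

definition dom_M ::
    "(real \<times> real \<Rightarrow> real) \<Rightarrow> (real \<times> real \<Rightarrow> real) \<Rightarrow> real \<Rightarrow> (real \<times> real \<times> real \<times> real \<times> real) set" where
  "dom_M k0 k1 M = {(x, u, y, v, z). 0 \<le> x \<and> x \<le> 1 \<and> \<bar>u\<bar> \<le> M0 * M \<and> \<bar>y\<bar> \<le> M0 * M \<and>
     \<bar>v\<bar> \<le> M0 * kernel_bound k0 * M \<and> \<bar>z\<bar> \<le> M0 * kernel_bound k1 * M}"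

text \<open>
  Two-times continuous differentiability of \<open>f\<close>, a function on \<open>[0,1] \<times> \<real>\<^sup>4\<close>, in the closed set
  \<open>D\<close>: as usual for closed sets, the continuous partial derivatives exist in a neighbourhood of \<open>D\<close>,
  the neighbourhood being relative to \<open>[0,1] \<times> \<real>\<^sup>4\<close>.  Differentiability relative to \<open>D\<close> alone
  would say nothing about \<open>f\<close> outside \<open>D\<close>, where the discrete iteration can evaluate it
  (a trapezoidal sum of \<open>\<bar>k (x, -)\<bar>\<close> may exceed its integral).
\<close>

definition C2_near ::
    "(real \<times> real \<times> real \<times> real \<times> real) set \<Rightarrow> (real \<times> real \<times> real \<times> real \<times> real \<Rightarrow> real) \<Rightarrow> bool" where
  "C2_near D f \<longleftrightarrow> (\<exists>W. open W \<and> D \<subseteq> W \<and> Ck_on 2 (W \<inter> ({0..1} \<times> UNIV)) f)"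

text \<open>\<open>u \<in> C\<^sup>4[0,1]\<close> solves the problem; \<open>u1, \<dots>, u4\<close> are its derivatives on \<open>[0,1]\<close>.\<close>

definition bvp_solution ::
    "(real \<times> real \<times> real \<times> real \<times> real \<Rightarrow> real) \<Rightarrow> (real \<times> real \<Rightarrow> real) \<Rightarrow> (real \<times> real \<Rightarrow> real) \<Rightarrow>
     (real \<Rightarrow> real) \<Rightarrow> (real \<Rightarrow> real) \<Rightarrow> bool" where
  "bvp_solution f k0 k1 \<phi> u \<longleftrightarrow> (\<exists>u1 u2 u3 u4.
     (\<forall>x\<in>{0..1}. (u has_real_derivative u1 x) (at x within {0..1}) \<and>
                  (u1 has_real_derivative u2 x) (at x within {0..1}) \<and>
                  (u2 has_real_derivative u3 x) (at x within {0..1}) \<and>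
                  (u3 has_real_derivative u4 x) (at x within {0..1})) \<and>
     continuous_on {0..1} u4 \<and>
     (\<forall>x\<in>{0..1}. u4 x = f (x, u x, u (\<phi> x),
                             integral {0..1} (\<lambda>t. k0 (x, t) * u t),
                             integral {0..1} (\<lambda>t. k1 (x, t) * u (\<phi> t)))) \<and>
     u 0 = 0 \<and> u 1 = 0 \<and> u2 0 = 0 \<and> u2 1 = 0)"

definition green_op :: "(real \<Rightarrow> real) \<Rightarrow> real \<Rightarrow> real" where
  "green_op \<psi> x = integral {0..1} (\<lambda>t. green x t * \<psi> t)"

primrec psi ::
    "(real \<times> real \<times> real \<times> real \<times> real \<Rightarrow> real) \<Rightarrow> (real \<times> real \<Rightarrow> real) \<Rightarrow> (real \<times> real \<Rightarrow> real) \<Rightarrow>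
     (real \<Rightarrow> real) \<Rightarrow> nat \<Rightarrow> real \<Rightarrow> real" where
  "psi f k0 k1 \<phi> 0 = (\<lambda>x. f (x, 0, 0, 0, 0))"
| "psi f k0 k1 \<phi> (Suc m) =
     (let u = green_op (psi f k0 k1 \<phi> m);
          y = (\<lambda>x. green_op (psi f k0 k1 \<phi> m) (\<phi> x));
          v = (\<lambda>x. integral {0..1} (\<lambda>t. k0 (x, t) * u t));
          z = (\<lambda>x. integral {0..1} (\<lambda>t. k1 (x, t) * y t))
      in (\<lambda>x. f (x, u x, y x, v x, z x)))"

text \<open>Grid functions are functions of the index \<open>i \<in> {0..N}\<close> of the node \<open>x\<^sub>i = i / N\<close>.\<close>

definition node :: "nat \<Rightarrow> nat \<Rightarrow> real" where
  "node N i = real i / real N"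

definition trap_sum :: "nat \<Rightarrow> (nat \<Rightarrow> real) \<Rightarrow> real" where
  "trap_sum N w = (\<Sum>j=0..N. (1 / real N) * (if j = 0 \<or> j = N then 1/2 else 1) * w j)"

definition green_disc :: "nat \<Rightarrow> (nat \<Rightarrow> real) \<Rightarrow> real \<Rightarrow> real" where
  "green_disc N \<Psi> x = trap_sum N (\<lambda>j. green x (node N j) * \<Psi> j)"

primrec Psi_disc ::
    "(real \<times> real \<times> real \<times> real \<times> real \<Rightarrow> real) \<Rightarrow> (real \<times> real \<Rightarrow> real) \<Rightarrow> (real \<times> real \<Rightarrow> real) \<Rightarrow>
     (real \<Rightarrow> real) \<Rightarrow> nat \<Rightarrow> nat \<Rightarrow> nat \<Rightarrow> real" where
  "Psi_disc f k0 k1 \<phi> N 0 = (\<lambda>i. f (node N i, 0, 0, 0, 0))"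
| "Psi_disc f k0 k1 \<phi> N (Suc m) =
     (let U = (\<lambda>i. green_disc N (Psi_disc f k0 k1 \<phi> N m) (node N i));
          Y = (\<lambda>i. green_disc N (Psi_disc f k0 k1 \<phi> N m) (\<phi> (node N i)));
          V = (\<lambda>i. trap_sum N (\<lambda>j. k0 (node N i, node N j) * U j));
          Z = (\<lambda>i. trap_sum N (\<lambda>j. k1 (node N i, node N j) * Y j))
      in (\<lambda>i. f (node N i, U i, Y i, V i, Z i)))"

definition U_disc ::
    "(real \<times> real \<times> real \<times> real \<times> real \<Rightarrow> real) \<Rightarrow> (real \<times> real \<Rightarrow> real) \<Rightarrow> (real \<times> real \<Rightarrow> real) \<Rightarrow>
     (real \<Rightarrow> real) \<Rightarrow> nat \<Rightarrow> nat \<Rightarrow> nat \<Rightarrow> real" where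
  "U_disc f k0 k1 \<phi> N m i = green_disc N (Psi_disc f k0 k1 \<phi> N m) (node N i)"

definition grid_norm :: "nat \<Rightarrow> (nat \<Rightarrow> real) \<Rightarrow> real" where
  "grid_norm N w = Max ((\<lambda>i. \<bar>w i\<bar>) ` {0..N})"

end

theory Submission
  imports Defs
begin

text \<open>
  The total error splits into the error of the continuous iteration and the discretisation error
  of each single iterate.

  Continuous iteration.  Integration by parts against the Green function shows that the solution is
  \<open>u = green_op u4\<close> with \<open>u4\<close> its fourth derivative (\<open>green_representation\<close>), so \<open>u4\<close> is a fixed point
  of the map that sends \<open>\<psi>\<^sub>m\<close> to \<open>\<psi>\<^bsub>m+1\<^esub>\<close>.  All arguments at which \<open>f\<close> is evaluated stay in
  \<open>dom_M\<close>, where the Lipschitz condition makes the map a \<open>q\<close>-contraction in the maximum norm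
  (\<open>psi_Suc_error\<close>).  From \<open>\<parallel>\<psi>\<^sub>0 - u4\<parallel> \<le> d + q \<parallel>\<psi>\<^sub>0 - u4\<parallel>\<close> the bound \<open>q\<^sup>m d / (1 - q)\<close> on
  \<open>\<psi>\<^sub>m - u4\<close> follows, and applying the Green operator costs a factor \<open>M0\<close>.

  Discretisation.  For fixed \<open>m\<close>, induction shows that \<open>Psi_disc\<close> differs from \<open>\<psi>\<^sub>m\<close> at the nodes by
  \<open>O(h\<^sup>2)\<close> (\<open>Psi_disc_error\<close>): the trapezoidal weights have total mass 1, so earlier errors are amplified
  at most by a bound for the kernel; the trapezoidal rule itself is accurate to second order on the
  integrands; and \<open>f\<close> is Lipschitz.  The Lipschitz property is needed slightly outside \<open>dom_M\<close>, since the discrete arguments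
  are only close to \<open>dom_M\<close>.  This is where a box around \<open>dom_M\<close> comes in on which \<open>f\<close> is still
  twice continuously differentiable, and why the estimate is asymptotic in \<open>N\<close>.

  Regularity.  Second order accuracy needs regular integrands, hence regular \<open>\<psi>\<^sub>m\<close>, although \<open>\<psi>\<^sub>m\<close>
  is built from \<open>f\<close> by a composition in five variables.  Instead of second derivatives, a quantitative
  class \<open>C11_on S K\<close> is propagated: bounded by \<open>K\<close>, \<open>K\<close>-Lipschitz, and within \<open>K \<parallel>p - q\<parallel>\<^sup>2\<close> of linear
  interpolation between any two points.  It contains the twice continuously differentiable functions
  on a box (\<open>Ck_on_2_imp_C11_on\<close>), its closure properties under products, compositions and parameter
  integrals have short direct proofs, and its third condition is precisely what bounds the
  trapezoidal error on one panel.
\<close>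

section \<open>Functions close to their linear interpolants\<close>

text \<open>
  On a convex set the last condition with a uniform constant is a derivative-free form of having a
  Lipschitz continuous derivative, whence the name.  One constant serves all three conditions, so that
  closure properties have a single parameter to track.
\<close>

definition C11_on :: "'a::real_normed_vector set \<Rightarrow> real \<Rightarrow> ('a \<Rightarrow> 'b::real_normed_vector) \<Rightarrow> bool" where
  "C11_on S K g \<longleftrightarrow>
     (\<forall>p\<in>S. norm (g p) \<le> K) \<and>
     (\<forall>p\<in>S. \<forall>q\<in>S. norm (g p - g q) \<le> K * norm (p - q)) \<and>
     (\<forall>p\<in>S. \<forall>q\<in>S. \<forall>t\<in>{0..1}.
        norm (g ((1 - t) *\<^sub>R p + t *\<^sub>R q) - ((1 - t) *\<^sub>R g p + t *\<^sub>R g q)) \<le> K * (norm (p - q))\<^sup>2)"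

lemma C11_onI:
  assumes "\<And>p. p \<in> S \<Longrightarrow> norm (g p) \<le> K"
    and "\<And>p q. p \<in> S \<Longrightarrow> q \<in> S \<Longrightarrow> norm (g p - g q) \<le> K * norm (p - q)"
    and "\<And>p q t. p \<in> S \<Longrightarrow> q \<in> S \<Longrightarrow> 0 \<le> t \<Longrightarrow> t \<le> 1 \<Longrightarrow>
      norm (g ((1 - t) *\<^sub>R p + t *\<^sub>R q) - ((1 - t) *\<^sub>R g p + t *\<^sub>R g q)) \<le> K * (norm (p - q))\<^sup>2"
  shows "C11_on S K g"
  using assms unfolding C11_on_def by auto

lemma C11_onD:
  assumes "C11_on S K g"
  shows C11_on_bound: "p \<in> S \<Longrightarrow> norm (g p) \<le> K"
    and C11_on_lipschitz: "p \<in> S \<Longrightarrow> q \<in> S \<Longrightarrow> norm (g p - g q) \<le> K * norm (p - q)"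
    and C11_on_interp: "p \<in> S \<Longrightarrow> q \<in> S \<Longrightarrow> 0 \<le> t \<Longrightarrow> t \<le> 1 \<Longrightarrow>
      norm (g ((1 - t) *\<^sub>R p + t *\<^sub>R q) - ((1 - t) *\<^sub>R g p + t *\<^sub>R g q)) \<le> K * (norm (p - q))\<^sup>2"
  using assms unfolding C11_on_def by auto

lemma C11_on_nonneg:
  assumes "C11_on S K g" "S \<noteq> {}"
  shows "0 \<le> K"
  using assms C11_on_bound norm_ge_zero order_trans by (metis all_not_in_conv)

lemma C11_on_mono:
  assumes "C11_on S K g" "K \<le> K'"
  shows "C11_on S K' g"
  using assms unfolding C11_on_def
  by (meson mult_right_mono norm_ge_zero order_trans zero_le_power2)

lemma C11_on_continuous:
  assumes "C11_on S K g"
  shows "continuous_on S g"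
proof (cases "S = {}")
  case False
  have "K-lipschitz_on S g"
    using C11_on_lipschitz[OF assms] C11_on_nonneg[OF assms False]
    by (intro lipschitz_onI) (auto simp: dist_norm)
  then show ?thesis by (rule lipschitz_on_continuous_on)
qed auto

lemma C11_on_Pair:
  assumes g: "C11_on S K g" and h: "C11_on S K' h"
  shows "C11_on S (K + K') (\<lambda>x. (g x, h x))"
proof (rule C11_onI)
  show "norm (g p, h p) \<le> K + K'" if "p \<in> S" for p
    using C11_on_bound[OF g that] C11_on_bound[OF h that] norm_Pair_le[of "g p" "h p"] by linarith
  show "norm ((g p, h p) - (g q, h q)) \<le> (K + K') * norm (p - q)" if "p \<in> S" "q \<in> S" for p q
    using C11_on_lipschitz[OF g that] C11_on_lipschitz[OF h that]
      norm_Pair_le[of "g p - g q" "h p - h q"] by (simp add: algebra_simps)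
  fix p q t assume *: "p \<in> S" "q \<in> S" "(0::real) \<le> t" "t \<le> 1"
  let ?c = "(1 - t) *\<^sub>R p + t *\<^sub>R q"
  show "norm ((g ?c, h ?c) - ((1 - t) *\<^sub>R (g p, h p) + t *\<^sub>R (g q, h q))) \<le> (K + K') * (norm (p - q))\<^sup>2"
    using C11_on_interp[OF g *] C11_on_interp[OF h *]
      norm_Pair_le[of "g ?c - ((1 - t) *\<^sub>R g p + t *\<^sub>R g q)" "h ?c - ((1 - t) *\<^sub>R h p + t *\<^sub>R h q)"]
    by (simp add: distrib_right)
qed

lemma C11_on_ident_unit: "C11_on {0..1::real} 1 (\<lambda>x. x)"
  by (rule C11_onI) auto

lemma C11_on_const: "C11_on S (norm c) (\<lambda>x. c)"
  by (rule C11_onI) (auto simp flip: scaleR_left_distrib)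

lemma C11_on_mult_const:
  fixes g :: "'a::real_normed_vector \<Rightarrow> real"
  assumes g: "C11_on S K g" and c: "\<bar>c\<bar> \<le> C"
  shows "C11_on S (K * C) (\<lambda>x. g x * c)"
proof (rule C11_onI)
  fix p q t assume *: "p \<in> S" "q \<in> S" "(0::real) \<le> t" "t \<le> 1"
  have "norm (g ((1 - t) *\<^sub>R p + t *\<^sub>R q) * c - ((1 - t) *\<^sub>R (g p * c) + t *\<^sub>R (g q * c)))
      = norm (g ((1 - t) *\<^sub>R p + t *\<^sub>R q) - ((1 - t) *\<^sub>R g p + t *\<^sub>R g q)) * \<bar>c\<bar>"
    by (simp add: abs_mult[symmetric] algebra_simps)
  also have "\<dots> \<le> (K * (norm (p - q))\<^sup>2) * C"
    using C11_on_interp[OF g *] c by (intro mult_mono) (auto intro: order_trans[OF norm_ge_zero])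
  finally show "norm (g ((1 - t) *\<^sub>R p + t *\<^sub>R q) * c - ((1 - t) *\<^sub>R (g p * c) + t *\<^sub>R (g q * c)))
      \<le> K * C * (norm (p - q))\<^sup>2" by (simp add: mult_ac)
next
  fix p assume "p \<in> S"
  then show "norm (g p * c) \<le> K * C"
    using C11_on_bound[OF g] c C11_on_nonneg[OF g] by (auto simp: abs_mult intro!: mult_mono)
next
  fix p q assume *: "p \<in> S" "q \<in> S"
  have "norm (g p * c - g q * c) = norm (g p - g q) * \<bar>c\<bar>"
    by (simp add: abs_mult[symmetric] algebra_simps)
  also have "\<dots> \<le> (K * norm (p - q)) * C"
    using C11_on_lipschitz[OF g *] c by (intro mult_mono) (auto intro: order_trans[OF norm_ge_zero])
  finally show "norm (g p * c - g q * c) \<le> K * C * norm (p - q)" by (simp add: mult_ac)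
qed

text \<open>
  At an intermediate point the product of two affine functions differs from the affine interpolant of
  the product by \<open>t (1 - t)\<close> times the product of the increments; the Lipschitz conditions make
  this term quadratic.
\<close>

lemma C11_on_mult:
  fixes g h :: "'a::real_normed_vector \<Rightarrow> real"
  assumes g: "C11_on S K g" and h: "C11_on S K' h" and S: "convex S"
  shows "C11_on S (3 * K * K') (\<lambda>x. g x * h x)"
proof (cases "S = {}")
  case False
  have K: "0 \<le> K" "0 \<le> K'" using C11_on_nonneg g h False by blast+
  show ?thesis
  proof (rule C11_onI)
    fix p assume "p \<in> S"
    then have "norm (g p * h p) \<le> K * K'"
      using C11_on_bound[OF g] C11_on_bound[OF h] K by (auto simp: abs_mult intro!: mult_mono)
    then show "norm (g p * h p) \<le> 3 * K * K'" 
      using mult_nonneg_nonneg[OF K] by (simp add: mult.assoc)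
  next
    fix p q assume *: "p \<in> S" "q \<in> S"
    have "norm (g p * h p - g q * h q) = \<bar>(g p - g q) * h p + g q * (h p - h q)\<bar>"
      by (simp add: algebra_simps)
    also have "\<dots> \<le> \<bar>g p - g q\<bar> * \<bar>h p\<bar> + \<bar>g q\<bar> * \<bar>h p - h q\<bar>"
      by (metis abs_mult abs_triangle_ineq)
    also have "\<dots> \<le> (K * norm (p - q)) * K' + K * (K' * norm (p - q))"
      using C11_on_bound[OF g] C11_on_bound[OF h] C11_on_lipschitz[OF g *] C11_on_lipschitz[OF h *] K *
      by (intro add_mono mult_mono) auto
    also have "\<dots> = 2 * (K * K' * norm (p - q))" by simp
    also have "\<dots> \<le> 3 * (K * K' * norm (p - q))" using K by (intro mult_right_mono) auto
    finally show "norm (g p * h p - g q * h q) \<le> 3 * K * K' * norm (p - q)" by (simp add: mult_ac)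
  next
    fix p q t assume *: "p \<in> S" "q \<in> S" "(0::real) \<le> t" "t \<le> 1"
    define c where "c = (1 - t) *\<^sub>R p + t *\<^sub>R q"
    have cS: "c \<in> S" using * S unfolding c_def convex_alt by blast
    define a where "a = (1 - t) * g p + t * g q"
    define b where "b = (1 - t) * h p + t * h q"
    define D where "D = norm (p - q)"
    have ga: "\<bar>g c - a\<bar> \<le> K * D\<^sup>2" and hb: "\<bar>h c - b\<bar> \<le> K' * D\<^sup>2"
      using C11_on_interp[OF g *] C11_on_interp[OF h *] by (auto simp: a_def b_def c_def D_def)
    have gp: "\<bar>g p\<bar> \<le> K" "\<bar>g q\<bar> \<le> K" and hc: "\<bar>h c\<bar> \<le> K'"
      using C11_on_bound[OF g] C11_on_bound[OF h] cS * by auto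
    have "\<bar>a\<bar> \<le> (1 - t) * \<bar>g p\<bar> + t * \<bar>g q\<bar>"
      unfolding a_def using * by (intro order_trans[OF abs_triangle_ineq]) (simp add: abs_mult)
    also have "\<dots> \<le> (1 - t) * K + t * K" using * gp by (intro add_mono mult_left_mono) auto
    finally have aK: "\<bar>a\<bar> \<le> K" by (simp add: algebra_simps)
    have dg: "\<bar>g p - g q\<bar> \<le> K * D" and dh: "\<bar>h p - h q\<bar> \<le> K' * D"
      using C11_on_lipschitz[OF g *(1,2)] C11_on_lipschitz[OF h *(1,2)] by (auto simp: D_def)
    have t1: "\<bar>t * (1 - t)\<bar> \<le> 1" using * by (auto simp: abs_mult intro!: mult_le_one)
    have "g c * h c - ((1 - t) * (g p * h p) + t * (g q * h q))
        = (g c - a) * h c + a * (h c - b) - t * (1 - t) * ((g p - g q) * (h p - h q))"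
      unfolding a_def b_def by (simp add: algebra_simps power2_eq_square)
    also have "\<bar>\<dots>\<bar> \<le> \<bar>g c - a\<bar> * \<bar>h c\<bar> + \<bar>a\<bar> * \<bar>h c - b\<bar> + \<bar>t * (1 - t)\<bar> * (\<bar>g p - g q\<bar> * \<bar>h p - h q\<bar>)"
      unfolding abs_mult[symmetric] by linarith
    also have "\<dots> \<le> (K * D\<^sup>2) * K' + K * (K' * D\<^sup>2) + 1 * ((K * D) * (K' * D))"
      using ga hb hc aK dg dh t1 K by (intro add_mono mult_mono) (auto simp: D_def)
    also have "\<dots> = 3 * K * K' * D\<^sup>2" by (simp add: power2_eq_square algebra_simps)
    finally show "norm (g ((1 - t) *\<^sub>R p + t *\<^sub>R q) * h ((1 - t) *\<^sub>R p + t *\<^sub>R q)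
        - ((1 - t) *\<^sub>R (g p * h p) + t *\<^sub>R (g q * h q))) \<le> 3 * K * K' * (norm (p - q))\<^sup>2"
      by (simp add: c_def D_def)
  qed
qed (simp add: C11_on_def)

text \<open>
  Replacing \<open>X\<close> at an intermediate point by its linear interpolant costs a quadratic error, because \<open>F\<close> is
  Lipschitz; afterwards the interpolation property of \<open>F\<close> applies, and \<open>\<parallel>X p - X q\<parallel>\<close> is linear in
  \<open>\<parallel>p - q\<parallel>\<close>.  Convexity of \<open>T\<close> puts the interpolant into the domain of \<open>F\<close>.
\<close>

lemma C11_on_compose:
  assumes X: "C11_on S K X" and F: "C11_on T L F" and XT: "X ` S \<subseteq> T"
    and S: "convex S" and T: "convex T"
  shows "C11_on S (L + L * K + L * K\<^sup>2) (\<lambda>x. F (X x))"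
proof (cases "S = {}")
  case False
  have K: "0 \<le> K" "0 \<le> L" using C11_on_nonneg X F False XT by blast+
  show ?thesis
  proof (rule C11_onI)
    fix p assume "p \<in> S"
    then show "norm (F (X p)) \<le> L + L * K + L * K\<^sup>2"
      using C11_on_bound[OF F, of "X p"] XT K by (smt (verit) image_subset_iff mult_nonneg_nonneg zero_le_power2)
  next
    fix p q assume *: "p \<in> S" "q \<in> S"
    have "norm (F (X p) - F (X q)) \<le> L * norm (X p - X q)"
      using C11_on_lipschitz[OF F] XT * by blast
    also have "\<dots> \<le> L * (K * norm (p - q))" using C11_on_lipschitz[OF X *] K by (intro mult_left_mono)
    also have "\<dots> \<le> (L + L * K + L * K\<^sup>2) * norm (p - q)"
      using K by (simp add: distrib_right)
    finally show "norm (F (X p) - F (X q)) \<le> (L + L * K + L * K\<^sup>2) * norm (p - q)" .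
  next
    fix p q t assume *: "p \<in> S" "q \<in> S" "(0::real) \<le> t" "t \<le> 1"
    define c where "c = (1 - t) *\<^sub>R p + t *\<^sub>R q"
    have cS: "c \<in> S" using * S unfolding c_def convex_alt by blast
    define a where "a = (1 - t) *\<^sub>R X p + t *\<^sub>R X q"
    have XT': "X p \<in> T" "X q \<in> T" "X c \<in> T" using XT * cS by auto
    have aT: "a \<in> T" using * T XT' unfolding a_def convex_alt by blast
    have "norm (F (X c) - F a) \<le> L * norm (X c - a)" using C11_on_lipschitz[OF F] XT' aT by blast
    also have "\<dots> \<le> L * (K * (norm (p - q))\<^sup>2)"
      using C11_on_interp[OF X *] K unfolding a_def c_def by (intro mult_left_mono)
    finally have 1: "norm (F (X c) - F a) \<le> L * K * (norm (p - q))\<^sup>2" by (simp add: mult_ac)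
    have "norm (F a - ((1 - t) *\<^sub>R F (X p) + t *\<^sub>R F (X q))) \<le> L * (norm (X p - X q))\<^sup>2"
      using C11_on_interp[OF F XT'(1,2) *(3,4)] unfolding a_def .
    also have "\<dots> \<le> L * (K * norm (p - q))\<^sup>2"
      using C11_on_lipschitz[OF X *(1,2)] K by (intro mult_left_mono power_mono) auto
    finally have 2: "norm (F a - ((1 - t) *\<^sub>R F (X p) + t *\<^sub>R F (X q))) \<le> L * K\<^sup>2 * (norm (p - q))\<^sup>2"
      by (simp add: power_mult_distrib mult_ac)
    have "norm (F (X c) - ((1 - t) *\<^sub>R F (X p) + t *\<^sub>R F (X q)))
        \<le> norm (F (X c) - F a) + norm (F a - ((1 - t) *\<^sub>R F (X p) + t *\<^sub>R F (X q)))"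
      using norm_triangle_ineq[of "F (X c) - F a"] by (metis diff_add_cancel add_diff_eq)
    also have "\<dots> \<le> (L + L * K + L * K\<^sup>2) * (norm (p - q))\<^sup>2"
      using 1 2 mult_nonneg_nonneg[OF K(2) zero_le_power2[of "norm (p - q)"]]
      unfolding distrib_right by linarith
    finally show "norm (F (X ((1 - t) *\<^sub>R p + t *\<^sub>R q)) - ((1 - t) *\<^sub>R F (X p) + t *\<^sub>R F (X q)))
        \<le> (L + L * K + L * K\<^sup>2) * (norm (p - q))\<^sup>2" by (simp add: c_def)
  qed
qed (simp add: C11_on_def)

lemma C11_on_integral:
  fixes k :: "'a::real_normed_vector \<Rightarrow> real \<Rightarrow> real"
  assumes k: "\<And>t. t \<in> {0..1} \<Longrightarrow> C11_on S K (\<lambda>x. k x t)"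
    and int: "\<And>x. x \<in> S \<Longrightarrow> k x integrable_on {0..1}"
    and S: "convex S"
  shows "C11_on S K (\<lambda>x. integral {0..1} (k x))"
proof -
  have bd: "norm (integral {0..1} g) \<le> B"
    if "g integrable_on {0..1}" "\<And>t. t \<in> {0..1} \<Longrightarrow> norm (g t) \<le> B" for g :: "real \<Rightarrow> real" and B
  proof -
    have "norm (integral {0..1} g) \<le> integral {0..1} (\<lambda>t::real. B)"
      using that by (intro integral_norm_bound_integral) auto
    then show ?thesis by simp
  qed
  show ?thesis
  proof (rule C11_onI)
    fix p assume "p \<in> S"
    then show "norm (integral {0..1} (k p)) \<le> K"
      using C11_on_bound[OF k] int by (intro bd) auto
  next
    fix p q assume *: "p \<in> S" "q \<in> S"
    have "integral {0..1} (k p) - integral {0..1} (k q) = integral {0..1} (\<lambda>t. k p t - k q t)"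
      using int * by (simp add: integral_diff)
    also have "norm \<dots> \<le> K * norm (p - q)"
      using C11_on_lipschitz[OF k] int * by (intro bd integrable_diff) auto
    finally show "norm (integral {0..1} (k p) - integral {0..1} (k q)) \<le> K * norm (p - q)" .
  next
    fix p q t assume *: "p \<in> S" "q \<in> S" "(0::real) \<le> t" "t \<le> 1"
    define c where "c = (1 - t) *\<^sub>R p + t *\<^sub>R q"
    have cS: "c \<in> S" using * S unfolding c_def convex_alt by blast
    have i: "k c integrable_on {0..1}" "(\<lambda>s. (1 - t) * k p s) integrable_on {0..1}"
      "(\<lambda>s. t * k q s) integrable_on {0..1}"
      using int * cS by (auto intro: integrable_on_mult_right)
    have "integral {0..1} (k c) - ((1 - t) *\<^sub>R integral {0..1} (k p) + t *\<^sub>R integral {0..1} (k q))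
        = integral {0..1} (\<lambda>s. k c s - ((1 - t) * k p s + t * k q s))"
      using i by (subst integral_diff) (auto intro!: integrable_add simp: integral_add)
    also have "norm \<dots> \<le> K * (norm (p - q))\<^sup>2"
      using C11_on_interp[OF k *] i unfolding c_def by (intro bd integrable_diff integrable_add) auto
    finally show "norm (integral {0..1} (k ((1 - t) *\<^sub>R p + t *\<^sub>R q))
        - ((1 - t) *\<^sub>R integral {0..1} (k p) + t *\<^sub>R integral {0..1} (k q))) \<le> K * (norm (p - q))\<^sup>2"
      by (simp add: c_def)
  qed
qed

lemma C11_on_section_fst:
  assumes "C11_on (S \<times> T) K k" "t \<in> T"
  shows "C11_on S K (\<lambda>x. k (x, t))"
proof -
  have n: "norm ((p, t) - (q, t)) = norm (p - q)" for p q :: 'a by (simp add: norm_Pair)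
  have c: "(1 - s) *\<^sub>R (p, t) + s *\<^sub>R (q, t) = ((1 - s) *\<^sub>R p + s *\<^sub>R q, t)" for s p q
    by (simp flip: scaleR_left_distrib)
  show ?thesis
    using C11_onD[OF assms(1)] assms(2) by (intro C11_onI) (metis n c mem_Sigma_iff)+
qed

lemma C11_on_section_snd:
  assumes "C11_on (S \<times> T) K k" "x \<in> S"
  shows "C11_on T K (\<lambda>t. k (x, t))"
proof -
  have n: "norm ((x, p) - (x, q)) = norm (p - q)" for p q :: 'b by (simp add: norm_Pair)
  have c: "(1 - s) *\<^sub>R (x, p) + s *\<^sub>R (x, q) = (x, (1 - s) *\<^sub>R p + s *\<^sub>R q)" for s p q
    by (simp flip: scaleR_left_distrib)
  show ?thesis
    using C11_onD[OF assms(1)] assms(2) by (intro C11_onI) (metis n c mem_Sigma_iff)+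
qed

section \<open>Twice continuously differentiable functions on a box\<close>

text \<open>
  One moves from \<open>p\<close> to \<open>q\<close> by changing one coordinate at a time.  The path stays inside the box and
  within distance \<open>\<parallel>q - p\<parallel>\<close> of \<open>p\<close>, and on each edge the mean value inequality applies to
  \<open>F\<close> minus the linear function with slope \<open>c i\<close>.  The case \<open>c = 0\<close> yields a Lipschitz bound, the
  case \<open>c i = F' i p\<close> the first order Taylor expansion; no total derivative is required.
\<close>

lemma partials_expansion:
  fixes F :: "'a::euclidean_space \<Rightarrow> real"
  assumes part: "\<And>i. i \<in> Basis \<Longrightarrow> has_partial_on (cbox a b) i F (F' i)"
    and p: "p \<in> cbox a b" and q: "q \<in> cbox a b"
    and close: "\<And>i x. i \<in> Basis \<Longrightarrow> x \<in> cbox a b \<Longrightarrow> norm (x - p) \<le> norm (q - p) \<Longrightarrow> \<bar>F' i x - c i\<bar> \<le> e"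
  shows "\<bar>F q - F p - (\<Sum>i\<in>Basis. c i * ((q - p) \<bullet> i))\<bar> \<le> DIM('a) * (e * norm (q - p))"
proof -
  \<comment> \<open>\<open>P A\<close> agrees with \<open>q\<close> in the coordinates in \<open>A\<close> and with \<open>p\<close> in the others.\<close>
  define P where "P A = p + (\<Sum>i\<in>A. ((q - p) \<bullet> i) *\<^sub>R i)" for A
  have e: "0 \<le> e"
  proof -
    obtain i :: 'a where "i \<in> Basis" using nonempty_Basis by blast
    then have "\<bar>F' i p - c i\<bar> \<le> e" using close p by simp
    then show ?thesis by linarith
  qed
  have coord: "P A \<bullet> j = (if j \<in> A then q \<bullet> j else p \<bullet> j)" if "A \<subseteq> Basis" "j \<in> Basis" for A j
  proof -
    have "finite A" using that finite_subset finite_Basis by blast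
    have "(\<Sum>i\<in>A. ((q - p) \<bullet> i) *\<^sub>R i) \<bullet> j = (\<Sum>i\<in>A. if i = j then (q - p) \<bullet> j else 0)"
      unfolding inner_sum_left using that by (intro sum.cong) (auto simp: inner_Basis)
    also have "\<dots> = (if j \<in> A then (q - p) \<bullet> j else 0)" using \<open>finite A\<close> by simp
    finally show ?thesis by (simp add: P_def inner_add_left inner_diff_left)
  qed
  have ind: "\<bar>F (P A) - F p - (\<Sum>i\<in>A. c i * ((q - p) \<bullet> i))\<bar> \<le> card A * (e * norm (q - p))"
    if "finite A" "A \<subseteq> Basis" for A
    using that
  proof (induction A rule: finite_induct)
    case empty
    then show ?case by (simp add: P_def)
  next
    case (insert i A)
    then have A: "A \<subseteq> Basis" "i \<in> Basis" "i \<notin> A" by auto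
    define \<delta> where "\<delta> = (q - p) \<bullet> i"
    define H where "H t = F (P A + t *\<^sub>R i) - c i * t" for t
    have inbox: "P A + t *\<^sub>R i \<in> cbox a b \<and> norm (P A + t *\<^sub>R i - p) \<le> norm (q - p)"
      if t: "t \<in> closed_segment 0 \<delta>" for t
    proof -
      have co: "(P A + t *\<^sub>R i) \<bullet> j = (if j \<in> A then q \<bullet> j else if j = i then p \<bullet> j + t else p \<bullet> j)"
        if "j \<in> Basis" for j
        using that coord[OF A(1) that] A by (auto simp: inner_add_left inner_Basis)
      have ti: "(0 \<le> t \<and> t \<le> \<delta>) \<or> (\<delta> \<le> t \<and> t \<le> 0)"
        using t by (auto simp: closed_segment_eq_real_ivl split: if_splits)
      have "P A + t *\<^sub>R i \<in> cbox a b"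
        unfolding mem_box
      proof (intro ballI)
        fix j :: 'a assume j: "j \<in> Basis"
        have "a \<bullet> j \<le> p \<bullet> j" "p \<bullet> j \<le> b \<bullet> j" "a \<bullet> j \<le> q \<bullet> j" "q \<bullet> j \<le> b \<bullet> j"
          using p q j by (auto simp: mem_box)
        then show "a \<bullet> j \<le> (P A + t *\<^sub>R i) \<bullet> j \<and> (P A + t *\<^sub>R i) \<bullet> j \<le> b \<bullet> j"
          unfolding co[OF j] using ti by (auto simp: \<delta>_def inner_diff_left)
      qed
      moreover have "norm (P A + t *\<^sub>R i - p) \<le> norm (q - p)"
      proof (rule norm_le_componentwise)
        fix j :: 'a assume j: "j \<in> Basis"
        show "\<bar>(P A + t *\<^sub>R i - p) \<bullet> j\<bar> \<le> \<bar>(q - p) \<bullet> j\<bar>"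
          unfolding inner_diff_left co[OF j] using ti by (auto simp: \<delta>_def inner_diff_left)
      qed
      ultimately show ?thesis by blast
    qed
    have der: "(H has_field_derivative F' i (P A + t *\<^sub>R i) - c i) (at t within closed_segment 0 \<delta>)"
      if t: "t \<in> closed_segment 0 \<delta>" for t
    proof -
      have "((\<lambda>s. F ((P A + t *\<^sub>R i) + s *\<^sub>R i)) has_real_derivative F' i (P A + t *\<^sub>R i))
              (at 0 within {s. (P A + t *\<^sub>R i) + s *\<^sub>R i \<in> cbox a b})"
        using part[OF A(2)] inbox[OF t] unfolding has_partial_on_def by blast
      then have "((\<lambda>s. F (P A + (t + s) *\<^sub>R i)) has_real_derivative F' i (P A + t *\<^sub>R i))
              (at 0 within {s. P A + (t + s) *\<^sub>R i \<in> cbox a b})"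
        by (simp add: scaleR_add_left add.assoc)
      then have "((\<lambda>s. F (P A + s *\<^sub>R i)) has_real_derivative F' i (P A + t *\<^sub>R i))
              (at (t + 0) within (+) t ` {s. P A + (t + s) *\<^sub>R i \<in> cbox a b})"
        by (subst DERIV_at_within_shift)
      then have "((\<lambda>s. F (P A + s *\<^sub>R i)) has_real_derivative F' i (P A + t *\<^sub>R i))
              (at t within closed_segment 0 \<delta>)"
        unfolding add_0_right
      proof (rule DERIV_subset)
        show "closed_segment 0 \<delta> \<subseteq> (+) t ` {s. P A + (t + s) *\<^sub>R i \<in> cbox a b}"
          using inbox by (force intro: image_eqI[of _ _ "s - t" for s])
      qed
      then show ?thesis
        unfolding H_def by (auto intro!: derivative_eq_intros)
    qed
    have "norm (H \<delta> - H 0) \<le> e * norm (\<delta> - 0)"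
    proof (rule field_differentiable_bound[where S = "closed_segment 0 \<delta>"])
      fix t assume t: "t \<in> closed_segment 0 \<delta>"
      show "norm (F' i (P A + t *\<^sub>R i) - c i) \<le> e"
        using close[OF A(2)] inbox[OF t] by simp
    qed (use der in auto)
    also have "\<dots> \<le> e * norm (q - p)"
      using e Basis_le_norm[OF A(2), of "q - p"] by (intro mult_left_mono) (auto simp: \<delta>_def)
    finally have step: "\<bar>H \<delta> - H 0\<bar> \<le> e * norm (q - p)" by simp
    have Pi: "P (insert i A) = P A + \<delta> *\<^sub>R i"
      using insert by (simp add: P_def \<delta>_def add_ac)
    have "F (P (insert i A)) - F p - (\<Sum>i\<in>insert i A. c i * ((q - p) \<bullet> i))
        = (F (P A) - F p - (\<Sum>i\<in>A. c i * ((q - p) \<bullet> i))) + (H \<delta> - H 0)"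
      using insert unfolding Pi H_def by (simp add: \<delta>_def algebra_simps)
    also have "\<bar>\<dots>\<bar> \<le> card A * (e * norm (q - p)) + e * norm (q - p)"
      using insert.IH A step by linarith
    also have "\<dots> = card (insert i A) * (e * norm (q - p))"
      using insert by (simp add: algebra_simps)
    finally show ?case .
  qed
  have "P Basis = q" by (simp add: P_def euclidean_representation)
  with ind[of Basis] show ?thesis by simp
qed

text \<open>
  For the interpolation condition, both endpoints are expanded around the intermediate point \<open>c\<close>: the
  linear terms cancel in the convex combination, and the remainders are quadratic because the first
  partial derivatives are Lipschitz.
\<close>

lemma C11_on_cbox_of_partials:
  fixes F :: "'a::euclidean_space \<Rightarrow> real" and K :: real
  assumes F: "\<And>x. x \<in> cbox a b \<Longrightarrow> \<bar>F x\<bar> \<le> K"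
    and part: "\<And>i. i \<in> Basis \<Longrightarrow> has_partial_on (cbox a b) i F (F' i)"
    and F': "\<And>i x. i \<in> Basis \<Longrightarrow> x \<in> cbox a b \<Longrightarrow> \<bar>F' i x\<bar> \<le> K"
    and part2: "\<And>i j. i \<in> Basis \<Longrightarrow> j \<in> Basis \<Longrightarrow> has_partial_on (cbox a b) j (F' i) (F'' i j)"
    and F'': "\<And>i j x. i \<in> Basis \<Longrightarrow> j \<in> Basis \<Longrightarrow> x \<in> cbox a b \<Longrightarrow> \<bar>F'' i j x\<bar> \<le> K"
  shows "C11_on (cbox a b) ((DIM('a))\<^sup>2 * K) F"
proof (cases "cbox a b = {}")
  case False
  have K: "0 \<le> K" using False F abs_ge_zero order_trans by (metis all_not_in_conv)
  define n where "n = real DIM('a)"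
  have n: "1 \<le> n" using DIM_positive[where 'a='a] unfolding n_def by linarith
  have n2: "n \<le> n\<^sup>2" "1 \<le> n\<^sup>2" using n self_le_power[OF n, of 2] one_le_power[OF n, of 2] by auto
  have lip: "\<bar>g q - g p\<bar> \<le> n * K * norm (q - p)"
    if g: "\<And>i. i \<in> Basis \<Longrightarrow> has_partial_on (cbox a b) i g (g' i)"
      "\<And>i x. i \<in> Basis \<Longrightarrow> x \<in> cbox a b \<Longrightarrow> \<bar>g' i x\<bar> \<le> K" and pq: "p \<in> cbox a b" "q \<in> cbox a b"
    for g :: "'a \<Rightarrow> real" and g' p q
  proof -
    have "\<bar>g q - g p - (\<Sum>i\<in>Basis. 0 * ((q - p) \<bullet> i))\<bar> \<le> DIM('a) * (K * norm (q - p))"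
      using g(2) by (intro partials_expansion[OF g(1) pq]) simp_all
    then show ?thesis unfolding n_def by simp
  qed
  have taylor: "\<bar>F q - F p - (\<Sum>i\<in>Basis. F' i p * ((q - p) \<bullet> i))\<bar> \<le> n\<^sup>2 * K * (norm (q - p))\<^sup>2"
    if pq: "p \<in> cbox a b" "q \<in> cbox a b" for p q
  proof -
    have "\<bar>F' i x - F' i p\<bar> \<le> n * K * norm (q - p)"
      if i: "i \<in> Basis" "x \<in> cbox a b" "norm (x - p) \<le> norm (q - p)" for i x
    proof -
      have "\<bar>F' i x - F' i p\<bar> \<le> n * K * norm (x - p)"
        using lip[OF part2 F'' pq(1) i(2)] i(1) by blast
      also have "\<dots> \<le> n * K * norm (q - p)" using i(3) n K by (intro mult_left_mono) auto
      finally show ?thesis .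
    qed
    then have "\<bar>F q - F p - (\<Sum>i\<in>Basis. F' i p * ((q - p) \<bullet> i))\<bar>
        \<le> DIM('a) * (n * K * norm (q - p) * norm (q - p))"
      by (intro partials_expansion[OF part pq, where c = "\<lambda>i. F' i p"])
    also have "\<dots> = n\<^sup>2 * K * (norm (q - p))\<^sup>2"
      unfolding n_def[symmetric] power2_eq_square by (simp only: mult_ac)
    finally show ?thesis .
  qed
  have "C11_on (cbox a b) (n\<^sup>2 * K) F"
  proof (rule C11_onI)
    fix p assume "p \<in> cbox a b"
    then show "norm (F p) \<le> n\<^sup>2 * K" 
      using F[of p] mult_right_mono[OF n2(2) K] by simp
  next
    fix p q assume "p \<in> cbox a b" "q \<in> cbox a b"
    then have "\<bar>F p - F q\<bar> \<le> n * K * norm (p - q)" using lip[OF part F'] by blast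
    also have "\<dots> \<le> n\<^sup>2 * K * norm (p - q)" using n2 K by (intro mult_right_mono) auto
    finally show "norm (F p - F q) \<le> n\<^sup>2 * K * norm (p - q)" by simp
  next
    fix p q t assume pq: "p \<in> cbox a b" "q \<in> cbox a b" "(0::real) \<le> t" "t \<le> 1"
    define c where "c = (1 - t) *\<^sub>R p + t *\<^sub>R q"
    define l where "l x = (\<Sum>i\<in>Basis. F' i c * ((x - c) \<bullet> i))" for x
    have c: "c \<in> cbox a b" using pq convex_box(1)[of a b] unfolding c_def convex_alt by blast
    have pc: "p - c = t *\<^sub>R (p - q)" and qc: "q - c = (1 - t) *\<^sub>R (q - p)"
      by (auto simp: c_def algebra_simps)
    have "norm (p - c) \<le> norm (p - q)" "norm (q - c) \<le> norm (p - q)"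
      unfolding pc qc using pq by (auto simp: mult_left_le_one_le norm_minus_commute)
    then have sq: "(norm (p - c))\<^sup>2 \<le> (norm (p - q))\<^sup>2" "(norm (q - c))\<^sup>2 \<le> (norm (p - q))\<^sup>2"
      by (auto intro: power_mono)
    have "n\<^sup>2 * K * (norm (p - c))\<^sup>2 \<le> n\<^sup>2 * K * (norm (p - q))\<^sup>2"
      "n\<^sup>2 * K * (norm (q - c))\<^sup>2 \<le> n\<^sup>2 * K * (norm (p - q))\<^sup>2"
      using sq K by (auto intro!: mult_left_mono)
    then have Tp: "\<bar>F p - F c - l p\<bar> \<le> n\<^sup>2 * K * (norm (p - q))\<^sup>2"
      and Tq: "\<bar>F q - F c - l q\<bar> \<le> n\<^sup>2 * K * (norm (p - q))\<^sup>2"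
      using taylor[OF c pq(1)] taylor[OF c pq(2)] unfolding l_def by linarith+
    have "(1 - t) * l p + t * l q = (\<Sum>i\<in>Basis. F' i c * (((1 - t) *\<^sub>R (p - c) + t *\<^sub>R (q - c)) \<bullet> i))"
      unfolding l_def sum_distrib_left sum.distrib[symmetric]
      by (intro sum.cong) (auto simp: inner_add_left algebra_simps)
    also have "(1 - t) *\<^sub>R (p - c) + t *\<^sub>R (q - c) = 0" by (simp add: c_def algebra_simps)
    finally have l0: "(1 - t) * l p + t * l q = 0" by simp
    have "F c - ((1 - t) * F p + t * F q)
        = - ((1 - t) * (F p - F c - l p) + t * (F q - F c - l q)) - ((1 - t) * l p + t * l q)"
      by (simp add: algebra_simps)
    also have "\<bar>\<dots>\<bar> \<le> (1 - t) * \<bar>F p - F c - l p\<bar> + t * \<bar>F q - F c - l q\<bar>"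
      unfolding l0 using pq abs_triangle_ineq[of "(1 - t) * (F p - F c - l p)" "t * (F q - F c - l q)"]
      by (simp add: abs_mult)
    also have "\<dots> \<le> (1 - t) * (n\<^sup>2 * K * (norm (p - q))\<^sup>2) + t * (n\<^sup>2 * K * (norm (p - q))\<^sup>2)"
      using Tp Tq pq by (intro add_mono mult_left_mono) auto
    also have "\<dots> = n\<^sup>2 * K * (norm (p - q))\<^sup>2" by (simp add: algebra_simps)
    finally show "norm (F ((1 - t) *\<^sub>R p + t *\<^sub>R q) - ((1 - t) *\<^sub>R F p + t *\<^sub>R F q)) \<le> n\<^sup>2 * K * (norm (p - q))\<^sup>2"
      by (simp add: c_def)
  qed
  then show ?thesis by (simp add: n_def)
qed (simp add: C11_on_def)

lemma has_partial_on_subset: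
  assumes "has_partial_on S b F F'" "T \<subseteq> S"
  shows "has_partial_on T b F F'"
  unfolding has_partial_on_def
proof
  fix p assume "p \<in> T"
  then have "((\<lambda>t. F (p + t *\<^sub>R b)) has_real_derivative F' p) (at 0 within {t. p + t *\<^sub>R b \<in> S})"
    using assms unfolding has_partial_on_def by blast
  then show "((\<lambda>t. F (p + t *\<^sub>R b)) has_real_derivative F' p) (at 0 within {t. p + t *\<^sub>R b \<in> T})"
    by (rule DERIV_subset) (use assms in auto)
qed

lemma Ck_on_subset:
  assumes "Ck_on k S F" "T \<subseteq> S"
  shows "Ck_on k T F"
  using assms(1)
proof (induction k arbitrary: F)
  case 0
  then show ?case using assms(2) continuous_on_subset by auto
next
  case (Suc k)
  have "\<exists>F'. has_partial_on T b F F' \<and> Ck_on k T F'" if "b \<in> Basis" for b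
    using Suc that has_partial_on_subset[OF _ assms(2)] by (auto, blast)
  then show ?case using Suc.prems continuous_on_subset[OF _ assms(2)] by auto
qed

lemma continuous_on_cbox_bounded:
  fixes g :: "'a::euclidean_space \<Rightarrow> real"
  assumes "continuous_on (cbox a b) g"
  shows "\<exists>K. \<forall>x\<in>cbox a b. \<bar>g x\<bar> \<le> K"
proof -
  have "bounded (g ` cbox a b)"
    using assms compact_imp_bounded[OF compact_continuous_image] compact_cbox by blast
  then show ?thesis unfolding bounded_iff by auto
qed

lemma Ck_on_2_imp_C11_on:
  fixes F :: "'a::euclidean_space \<Rightarrow> real"
  assumes "Ck_on 2 (cbox a b) F"
  shows "\<exists>K. C11_on (cbox a b) K F"
proof -
  let ?S = "cbox a b"
  have F: "continuous_on ?S F"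
    and "\<forall>i\<in>Basis. \<exists>G. has_partial_on ?S i F G \<and> continuous_on ?S G \<and>
           (\<forall>j\<in>Basis. \<exists>H. has_partial_on ?S j G H \<and> continuous_on ?S H)"
    using assms by (auto simp: numeral_2_eq_2)
  then obtain F' where F': "\<And>i. i \<in> Basis \<Longrightarrow> has_partial_on ?S i F (F' i) \<and> continuous_on ?S (F' i) \<and>
           (\<forall>j\<in>Basis. \<exists>H. has_partial_on ?S j (F' i) H \<and> continuous_on ?S H)"
    by metis
  then obtain F'' where F'': "\<And>i j. i \<in> Basis \<Longrightarrow> j \<in> Basis \<Longrightarrow>
      has_partial_on ?S j (F' i) (F'' i j) \<and> continuous_on ?S (F'' i j)"
    by metis
  obtain K where K: "\<And>x. x \<in> ?S \<Longrightarrow> \<bar>F x\<bar> \<le> K" using continuous_on_cbox_bounded[OF F] by blast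
  obtain K' where K': "\<And>i x. i \<in> Basis \<Longrightarrow> x \<in> ?S \<Longrightarrow> \<bar>F' i x\<bar> \<le> K' i"
    using bchoice[of Basis "\<lambda>i B. \<forall>x\<in>?S. \<bar>F' i x\<bar> \<le> B"] continuous_on_cbox_bounded F' by blast
  have "\<forall>i\<in>Basis. \<forall>j\<in>Basis. \<exists>B. \<forall>x\<in>?S. \<bar>F'' i j x\<bar> \<le> B"
    using continuous_on_cbox_bounded F'' by blast
  then obtain K'' where K'': "\<And>i j x. i \<in> Basis \<Longrightarrow> j \<in> Basis \<Longrightarrow> x \<in> ?S \<Longrightarrow> \<bar>F'' i j x\<bar> \<le> K'' i j"
    by metis
  define C where "C = Max ({K} \<union> K' ` Basis \<union> (\<lambda>(i, j). K'' i j) ` (Basis \<times> Basis))"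
  have C: "K \<le> C" "\<And>i. i \<in> Basis \<Longrightarrow> K' i \<le> C" "\<And>i j. i \<in> Basis \<Longrightarrow> j \<in> Basis \<Longrightarrow> K'' i j \<le> C"
    unfolding C_def by (rule Max_ge; force)+
  have "C11_on ?S ((DIM('a))\<^sup>2 * C) F"
  proof (rule C11_on_cbox_of_partials)
    show "\<bar>F x\<bar> \<le> C" if "x \<in> ?S" for x using K[OF that] C(1) by linarith
    show "has_partial_on ?S i F (F' i)" if "i \<in> Basis" for i using F' that by blast
    show "\<bar>F' i x\<bar> \<le> C" if "i \<in> Basis" "x \<in> ?S" for i x
      using K'[OF that] C(2)[OF that(1)] by linarith
    show "has_partial_on ?S j (F' i) (F'' i j)" if "i \<in> Basis" "j \<in> Basis" for i j
      using F'' that by blast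
    show "\<bar>F'' i j x\<bar> \<le> C" if "i \<in> Basis" "j \<in> Basis" "x \<in> ?S" for i j x
      using K''[OF that] C(3)[OF that(1,2)] by linarith
  qed
  then show ?thesis by blast
qed

lemma has_partial_on_real:
  fixes g :: "real \<Rightarrow> real"
  assumes "\<And>x. x \<in> S \<Longrightarrow> (g has_real_derivative g' x) (at x within S)"
  shows "has_partial_on S 1 g g'"
  unfolding has_partial_on_def
proof
  fix p assume "p \<in> S"
  then have d: "(g has_real_derivative g' p) (at (p + 0) within (+) p ` {t. p + t \<in> S})"
    by (simp, intro DERIV_subset[OF assms]) auto
  show "((\<lambda>t. g (p + t *\<^sub>R 1)) has_real_derivative g' p) (at 0 within {t. p + t *\<^sub>R 1 \<in> S})"
    using d[unfolded DERIV_at_within_shift] by simp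
qed

lemma C11_on_of_derivs:
  fixes g g1 g2 :: "real \<Rightarrow> real"
  assumes "\<And>x. x \<in> {a..b} \<Longrightarrow> (g has_real_derivative g1 x) (at x within {a..b})"
    and "\<And>x. x \<in> {a..b} \<Longrightarrow> (g1 has_real_derivative g2 x) (at x within {a..b})"
    and "\<And>x. x \<in> {a..b} \<Longrightarrow> \<bar>g x\<bar> \<le> K" "\<And>x. x \<in> {a..b} \<Longrightarrow> \<bar>g1 x\<bar> \<le> K" "\<And>x. x \<in> {a..b} \<Longrightarrow> \<bar>g2 x\<bar> \<le> K"
  shows "C11_on {a..b} K g"
proof -
  have "C11_on (cbox a b) ((DIM(real))\<^sup>2 * K) g"
    using assms
    by (intro C11_on_cbox_of_partials[where F' = "\<lambda>_. g1" and F'' = "\<lambda>_ _. g2"])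
      (auto intro!: has_partial_on_real simp: cbox_interval)
  then show ?thesis by (simp add: cbox_interval)
qed

section \<open>The trapezoidal rule\<close>

lemma trap_sum_eq_pairs:
  assumes "1 \<le> N"
  shows "trap_sum N w = (\<Sum>j<N. (1 / real N) * ((w j + w (Suc j)) / 2))"
proof -
  have "trap_sum N w = (\<Sum>j=0..N. (1 / real N) * w j - (1 / real N) *
      ((if j = 0 then w 0 / 2 else 0) + (if j = N then w N / 2 else 0)))"
    unfolding trap_sum_def using assms by (intro sum.cong) (auto simp: field_simps)
  also have "\<dots> = (1 / real N) * ((\<Sum>j=0..N. w j) - (w 0 + w N) / 2)"
    unfolding sum_subtractf sum_distrib_left[symmetric] sum.distrib
    by (simp add: right_diff_distrib add_divide_distrib)
  also have "(\<Sum>j=0..N. w j) - (w 0 + w N) / 2 = (\<Sum>j<N. (w j + w (Suc j)) / 2)"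
  proof -
    have "(\<Sum>j<N. w (Suc j)) = (\<Sum>j=0..N. w j) - w 0"
      using sum.lessThan_Suc_shift[of w N] by (simp add: lessThan_Suc_atMost atLeast0AtMost)
    moreover have "(\<Sum>j<N. w j) = (\<Sum>j=0..N. w j) - w N"
      using sum.lessThan_Suc[of w N] by (simp add: lessThan_Suc_atMost atLeast0AtMost)
    ultimately show ?thesis
      by (simp add: sum_divide_distrib[symmetric] sum.distrib field_simps)
  qed
  finally show ?thesis by (simp add: sum_distrib_left)
qed

lemma trap_sum_bound:
  assumes N: "1 \<le> N" and w: "\<And>j. j \<le> N \<Longrightarrow> \<bar>w j\<bar> \<le> e"
  shows "\<bar>trap_sum N w\<bar> \<le> e"
proof -
  have "\<bar>trap_sum N w\<bar> \<le> (\<Sum>j<N. (1 / real N) * e)"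
    unfolding trap_sum_eq_pairs[OF N]
  proof (intro order_trans[OF sum_abs] sum_mono)
    fix j assume "j \<in> {..<N}"
    then have "\<bar>(w j + w (Suc j)) / 2\<bar> \<le> e" using w[of j] w[of "Suc j"] by auto
    then show "\<bar>1 / real N * ((w j + w (Suc j)) / 2)\<bar> \<le> 1 / real N * e"
      unfolding abs_mult by (intro mult_mono) auto
  qed
  also have "\<dots> = e" using N by simp
  finally show ?thesis .
qed

lemma trap_sum_diff: "trap_sum N (\<lambda>j. v j - w j) = trap_sum N v - trap_sum N w"
  unfolding trap_sum_def by (simp add: sum_subtractf right_diff_distrib)

text \<open>
  The panel rule is the exact integral of the linear interpolant \<open>l\<close>, which is within
  \<open>K (b - a)\<^sup>2\<close> of \<open>g\<close>.
\<close>

lemma trapezoid_panel_error: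
  fixes g :: "real \<Rightarrow> real"
  assumes g: "C11_on {0..1} K g" and ab: "0 \<le> a" "a < b" "b \<le> 1"
  shows "\<bar>integral {a..b} g - (b - a) * ((g a + g b) / 2)\<bar> \<le> K * (b - a) ^ 3"
proof -
  define c where "c = (g b - g a) / (b - a)"
  have c: "(b - a) * c = g b - g a" using ab by (simp add: c_def)
  define l where "l x = g a + (x - a) * c" for x
  have "(l has_integral (g a * b + (b - a)\<^sup>2 / 2 * c) - (g a * a + (a - a)\<^sup>2 / 2 * c)) {a..b}"
    unfolding l_def using ab
    by (intro fundamental_theorem_of_calculus)
      (auto intro!: derivative_eq_intros simp: has_real_derivative_iff_has_vector_derivative[symmetric])
  also have "(g a * b + (b - a)\<^sup>2 / 2 * c) - (g a * a + (a - a)\<^sup>2 / 2 * c)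
      = (b - a) * (g a + ((b - a) * c) / 2)"
    by (simp add: power2_eq_square algebra_simps)
  also have "\<dots> = (b - a) * ((g a + g b) / 2)"
    unfolding c by (simp add: field_simps)
  finally have l: "(l has_integral ((b - a) * ((g a + g b) / 2))) {a..b}" .
  have gi: "g integrable_on {a..b}"
    using C11_on_continuous[OF g] ab by (intro integrable_continuous_interval) (auto elim: continuous_on_subset)
  have "integral {a..b} g - (b - a) * ((g a + g b) / 2) = integral {a..b} (\<lambda>x. g x - l x)"
    using l gi by (simp add: integral_diff has_integral_integrable integral_unique)
  also have "norm \<dots> \<le> integral {a..b} (\<lambda>x. K * (b - a)\<^sup>2)"
  proof (rule integral_norm_bound_integral)
    fix x assume x: "x \<in> {a..b}"
    define t where "t = (x - a) / (b - a)"
    have t: "0 \<le> t" "t \<le> 1" using x ab by (auto simp: t_def)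
    have "t * (b - a) = x - a" using ab by (simp add: t_def)
    then have xt: "(1 - t) * a + t * b = x" by (simp add: algebra_simps)
    have "(x - a) * c = t * (g b - g a)" by (simp add: c_def t_def)
    then have lt: "(1 - t) * g a + t * g b = l x" by (simp add: l_def algebra_simps)
    have "\<bar>g x - l x\<bar> \<le> K * \<bar>a - b\<bar>\<^sup>2"
      using C11_on_interp[OF g, of a b t] ab t by (simp add: xt lt)
    then show "norm (g x - l x) \<le> K * (b - a)\<^sup>2" by (simp add: power2_commute)
  qed (use l gi in \<open>auto intro!: integrable_diff\<close>)
  also have "\<dots> = K * (b - a) ^ 3" using ab by (simp add: power2_eq_square power3_eq_cube)
  finally show ?thesis by simp
qed

lemma integral_unit_panels:
  fixes g :: "real \<Rightarrow> real"
  assumes g: "g integrable_on {0..1}" and N: "1 \<le> N" and n: "n \<le> N"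
  shows "integral {0..node N n} g = (\<Sum>j<n. integral {node N j..node N (Suc j)} g)"
  using n
proof (induction n)
  case 0
  then show ?case by (simp add: node_def)
next
  case (Suc n)
  have o: "0 \<le> node N n" "node N n \<le> node N (Suc n)" "node N (Suc n) \<le> 1"
    using N Suc by (auto simp: node_def field_simps)
  have "g integrable_on {0..node N (Suc n)}"
    by (rule integrable_on_subinterval[OF g]) (use o in auto)
  then have "integral {0..node N (Suc n)} g
      = integral {0..node N n} g + integral {node N n..node N (Suc n)} g"
    by (rule Henstock_Kurzweil_Integration.integral_combine[OF o(1,2), symmetric])
  with Suc show ?case by simp
qed

lemma trapezoid_error:
  fixes g :: "real \<Rightarrow> real"
  assumes g: "C11_on {0..1} K g" and N: "1 \<le> N"
  shows "\<bar>trap_sum N (\<lambda>j. g (node N j)) - integral {0..1} g\<bar> \<le> K * (1 / real N)\<^sup>2"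
proof -
  have gi: "g integrable_on {0..1}"
    using C11_on_continuous[OF g] by (rule integrable_continuous_interval)
  have h: "node N (Suc j) - node N j = 1 / real N" for j
    using N by (simp add: node_def field_simps)
  have "node N N = 1" using N by (simp add: node_def)
  then have "trap_sum N (\<lambda>j. g (node N j)) - integral {0..1} g = (\<Sum>j<N.
      (1 / real N) * ((g (node N j) + g (node N (Suc j))) / 2) - integral {node N j..node N (Suc j)} g)"
    using integral_unit_panels[OF gi N order_refl] trap_sum_eq_pairs[OF N] by (simp add: sum_subtractf)
  also have "\<bar>\<dots>\<bar> \<le> (\<Sum>j<N. K * (1 / real N) ^ 3)"
  proof (intro order_trans[OF sum_abs] sum_mono)
    fix j assume "j \<in> {..<N}"
    then have "0 \<le> node N j" "node N j < node N (Suc j)" "node N (Suc j) \<le> 1"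
      using N by (auto simp: node_def field_simps)
    from trapezoid_panel_error[OF g this]
    show "\<bar>(1 / real N) * ((g (node N j) + g (node N (Suc j))) / 2)
        - integral {node N j..node N (Suc j)} g\<bar> \<le> K * (1 / real N) ^ 3"
      unfolding h by (simp add: abs_minus_commute)
  qed
  also have "\<dots> = K * (1 / real N)\<^sup>2"
    using N by (simp add: power2_eq_square power3_eq_cube)
  finally show ?thesis .
qed

text \<open>
  The form in which the rule enters the iteration: the factor \<open>g\<close> is known at the nodes only up to an
  error of the order of the rule itself.
\<close>

lemma trapezoid_error_perturbed:
  fixes k g :: "real \<Rightarrow> real"
  assumes k: "C11_on {0..1} \<kappa> k" and g: "C11_on {0..1} K g" and N: "1 \<le> N"
    and w: "\<And>j. j \<le> N \<Longrightarrow> \<bar>w j - g (node N j)\<bar> \<le> C * (1 / real N)\<^sup>2"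
  shows "\<bar>trap_sum N (\<lambda>j. k (node N j) * w j) - integral {0..1} (\<lambda>t. k t * g t)\<bar>
      \<le> (\<kappa> * C + 3 * \<kappa> * K) * (1 / real N)\<^sup>2"
proof -
  have node: "node N j \<in> {0..1}" if "j \<le> N" for j using that N by (simp add: node_def)
  have \<kappa>: "0 \<le> \<kappa>" using C11_on_nonneg[OF k] by simp
  have "\<bar>trap_sum N (\<lambda>j. k (node N j) * (w j - g (node N j)))\<bar> \<le> \<kappa> * (C * (1 / real N)\<^sup>2)"
    unfolding abs_mult using C11_on_bound[OF k] node w \<kappa>
    by (intro trap_sum_bound[OF N]) (auto simp: abs_mult intro!: mult_mono)
  moreover have "\<bar>trap_sum N (\<lambda>j. k (node N j) * g (node N j)) - integral {0..1} (\<lambda>t. k t * g t)\<bar>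
      \<le> 3 * \<kappa> * K * (1 / real N)\<^sup>2"
    using trapezoid_error[OF C11_on_mult[OF k g] N] by simp
  moreover have "trap_sum N (\<lambda>j. k (node N j) * w j)
      = trap_sum N (\<lambda>j. k (node N j) * (w j - g (node N j))) + trap_sum N (\<lambda>j. k (node N j) * g (node N j))"
    unfolding right_diff_distrib trap_sum_diff by simp
  ultimately show ?thesis by (simp add: distrib_right mult.assoc)
qed

section \<open>The Green function\<close>

text \<open>
  The two cubic branches of the Green function differ by \<open>(s - x)\<^sup>3 / 6\<close>, so truncated powers
  express it by a formula without case distinction, and show that it is twice differentiable across
  the diagonal.
\<close>

lemma DERIV_positive_part_power:
  "((\<lambda>w::real. (max 0 w) ^ Suc (Suc n)) has_real_derivative real (Suc (Suc n)) * (max 0 w) ^ Suc n) (at w)"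
proof -
  consider "w < 0" | "w > 0" | "w = 0" by linarith
  then show ?thesis
  proof cases
    case 1
    have "((\<lambda>w::real. 0) has_real_derivative 0) (at w)" by simp
    then have "((\<lambda>w::real. (max 0 w) ^ Suc (Suc n)) has_real_derivative 0) (at w)"
      by (rule has_field_derivative_transform_within_open[where S = "{..<0}"]) (use 1 in auto)
    then show ?thesis using 1 by simp
  next
    case 2
    have "((\<lambda>w::real. w ^ Suc (Suc n)) has_real_derivative real (Suc (Suc n)) * w ^ Suc n) (at w)"
      using DERIV_pow[of "Suc (Suc n)" w] by simp
    then have "((\<lambda>w::real. (max 0 w) ^ Suc (Suc n)) has_real_derivative real (Suc (Suc n)) * w ^ Suc n) (at w)"
      by (rule has_field_derivative_transform_within_open[where S = "{0<..}"]) (use 2 in auto)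
    then show ?thesis using 2 by simp
  next
    case 3
    have "((\<lambda>h::real. (max 0 h) ^ Suc n) \<longlongrightarrow> (max 0 0) ^ Suc n) (at 0)"
      by (intro tendsto_intros)
    then have "((\<lambda>h::real. (max 0 h) ^ Suc n) \<longlongrightarrow> 0) (at 0)" by simp
    moreover have "(max 0 h) ^ Suc n = (max 0 h) ^ Suc (Suc n) / h" if "h \<noteq> 0" for h :: real
      using that by (cases "h > 0") auto
    then have "\<forall>\<^sub>F h::real in at 0. (max 0 h) ^ Suc n = (max 0 h) ^ Suc (Suc n) / h"
      by (simp add: eventually_at_filter)
    ultimately have "((\<lambda>h::real. (max 0 h) ^ Suc (Suc n) / h) \<longlongrightarrow> 0) (at 0)"
      by (rule Lim_transform_eventually)
    then show ?thesis using 3 by (simp add: DERIV_def)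
  qed
qed

lemma green_eq_positive_part:
  "green x s = (1/6) * (s * (x - 1) * (x\<^sup>2 - 2 * x + s\<^sup>2) + (max 0 (s - x)) ^ 3)"
proof (cases "s \<le> x")
  case False
  then have "max 0 (s - x) = s - x" by simp
  then show ?thesis using False
    by (simp add: green_def power2_eq_square power3_eq_cube) (simp add: algebra_simps)
qed (simp add: green_def)

lemma green_commute: "green x s = green s x"
  unfolding green_def by auto

definition green_d1 :: "real \<Rightarrow> real \<Rightarrow> real" where
  "green_d1 x s = (1/6) * ((x - 1) * (x\<^sup>2 - 2 * x + 3 * s\<^sup>2) + 3 * (max 0 (s - x)) ^ 2)"

definition green_d2 :: "real \<Rightarrow> real \<Rightarrow> real" where
  "green_d2 x s = s * (x - 1) + max 0 (s - x)"

lemma green_deriv: "(green x has_real_derivative green_d1 x s) (at s within A)"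
proof -
  have sh: "((\<lambda>s. s - x) has_real_derivative 1) (at s)"
    by (auto intro!: derivative_eq_intros)
  have "((\<lambda>s. (max 0 (s - x)) ^ 3) has_real_derivative 3 * (max 0 (s - x)) ^ 2) (at s)"
    using DERIV_chain2[OF DERIV_positive_part_power[of 1] sh]
    by (simp add: numeral_2_eq_2 numeral_3_eq_3)
  moreover have "((\<lambda>s. (1/6) * (s * (x - 1) * (x\<^sup>2 - 2 * x + s\<^sup>2) + Q s)) has_real_derivative
      (1/6) * ((x - 1) * (x\<^sup>2 - 2 * x + 3 * s\<^sup>2) + Q')) (at s within A)"
    if "(Q has_real_derivative Q') (at s within A)" for Q Q'
    using that by (auto intro!: derivative_eq_intros simp: power2_eq_square algebra_simps)
  ultimately show ?thesis unfolding green_eq_positive_part[abs_def] green_d1_def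
    using has_field_derivative_at_within by blast
qed

lemma green_deriv2: "(green_d1 x has_real_derivative green_d2 x s) (at s within A)"
proof -
  have sh: "((\<lambda>s. s - x) has_real_derivative 1) (at s)"
    by (auto intro!: derivative_eq_intros)
  have "((\<lambda>s. (max 0 (s - x)) ^ 2) has_real_derivative 2 * (max 0 (s - x))) (at s)"
    using DERIV_chain2[OF DERIV_positive_part_power[of 0] sh]
    by (simp add: numeral_2_eq_2)
  moreover have "((\<lambda>s. (1/6) * ((x - 1) * (x\<^sup>2 - 2 * x + 3 * s\<^sup>2) + 3 * Q s)) has_real_derivative
      s * (x - 1) + Q' / 2) (at s within A)"
    if "(Q has_real_derivative Q') (at s within A)" for Q Q'
    using that by (auto intro!: derivative_eq_intros simp: power2_eq_square algebra_simps)
  ultimately show ?thesis unfolding green_d1_def[abs_def] green_d2_def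
    using has_field_derivative_at_within by fastforce
qed

text \<open>
  The constant does not depend on \<open>x\<close>, so parameter integrals over \<open>x\<close> and quadrature at
  arbitrary points such as \<open>\<phi> (node N i)\<close> inherit uniform bounds.
\<close>

lemma green_C11:
  assumes x: "x \<in> {0..1}"
  shows "C11_on {0..1} 4 (green x)"
proof (rule C11_on_of_derivs[OF green_deriv green_deriv2])
  fix s :: real assume s: "s \<in> {0..1}"
  have m: "0 \<le> max 0 (s - x)" "max 0 (s - x) \<le> 1" using x s by auto
  have a: "\<bar>s\<bar> \<le> 1" "\<bar>x - 1\<bar> \<le> 1" "\<bar>x\<^sup>2\<bar> \<le> 1" "\<bar>s\<^sup>2\<bar> \<le> 1" "\<bar>x\<bar> \<le> 1"
    using x s by (auto simp: power_le_one)
  have a4: "\<bar>x\<^sup>2 - 2 * x + s\<^sup>2\<bar> \<le> 4" "\<bar>x\<^sup>2 - 2 * x + 3 * s\<^sup>2\<bar> \<le> 6" using a by linarith+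
  have m3: "0 \<le> (max 0 (s - x)) ^ 3" "(max 0 (s - x)) ^ 3 \<le> 1" "0 \<le> (max 0 (s - x)) ^ 2" "(max 0 (s - x)) ^ 2 \<le> 1"
    using m by (auto intro: power_le_one)
  have sx: "\<bar>s * (x - 1)\<bar> \<le> 1" unfolding abs_mult using a by (intro mult_le_one) auto
  have "\<bar>s * (x - 1) * (x\<^sup>2 - 2 * x + s\<^sup>2)\<bar> \<le> 1 * 4"
    unfolding abs_mult[of "s * (x - 1)"] using sx a4 by (intro mult_mono) auto
  then have "\<bar>s * (x - 1) * (x\<^sup>2 - 2 * x + s\<^sup>2) + (max 0 (s - x)) ^ 3\<bar> \<le> 24" using m3 by linarith
  then show "\<bar>green x s\<bar> \<le> 4" unfolding green_eq_positive_part abs_mult by simp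
  have "\<bar>(x - 1) * (x\<^sup>2 - 2 * x + 3 * s\<^sup>2)\<bar> \<le> 1 * 6"
    unfolding abs_mult using a a4 by (intro mult_mono) auto
  then have "\<bar>(x - 1) * (x\<^sup>2 - 2 * x + 3 * s\<^sup>2) + 3 * (max 0 (s - x)) ^ 2\<bar> \<le> 24" using m3 by linarith
  then show "\<bar>green_d1 x s\<bar> \<le> 4" unfolding green_d1_def abs_mult[of "1/6"] by simp
  show "\<bar>green_d2 x s\<bar> \<le> 4" unfolding green_d2_def using sx m by linarith
qed

lemma continuous_on_green: "continuous_on A (green x)"
  using green_deriv by (meson DERIV_continuous_on)

lemma green_op_C11:
  assumes psi: "continuous_on {0..1} \<psi>" and C: "\<And>t. t \<in> {0..1} \<Longrightarrow> \<bar>\<psi> t\<bar> \<le> C"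
  shows "C11_on {0..1} (4 * C) (green_op \<psi>)"
  unfolding green_op_def[abs_def]
proof (rule C11_on_integral)
  fix t :: real assume t: "t \<in> {0..1}"
  have "C11_on {0..1} (4 * C) (\<lambda>x. green t x * \<psi> t)"
    using green_C11[OF t] C[OF t] by (rule C11_on_mult_const)
  then show "C11_on {0..1} (4 * C) (\<lambda>x. green x t * \<psi> t)" by (simp add: green_commute)
qed (auto intro!: integrable_continuous_interval continuous_intros continuous_on_green psi)

text \<open>
  Integration by parts on \<open>[0, x]\<close> and on \<open>[x, 1]\<close> with the antiderivatives \<open>L\<close> and \<open>R\<close>.  The third
  derivative of the Green function jumps from \<open>x - 1\<close> to \<open>x\<close> on the diagonal, and this unit jump leaves
  \<open>u x\<close>; all other terms cancel or vanish by the boundary conditions.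
\<close>

lemma green_representation:
  assumes u: "\<And>x. x \<in> {0..1} \<Longrightarrow> (u has_real_derivative u1 x) (at x within {0..1})"
    and u1: "\<And>x. x \<in> {0..1} \<Longrightarrow> (u1 has_real_derivative u2 x) (at x within {0..1})"
    and u2: "\<And>x. x \<in> {0..1} \<Longrightarrow> (u2 has_real_derivative u3 x) (at x within {0..1})"
    and u3: "\<And>x. x \<in> {0..1} \<Longrightarrow> (u3 has_real_derivative u4 x) (at x within {0..1})"
    and bc: "u 0 = 0" "u 1 = 0" "u2 0 = 0" "u2 1 = 0"
    and x: "x \<in> {0..1}"
  shows "green_op u4 x = u x"
proof -
  define L where "L s = green x s * u3 s - green_d1 x s * u2 s + s * (x - 1) * u1 s - (x - 1) * u s" for s
  define R where "R s = green x s * u3 s - green_d1 x s * u2 s + x * (s - 1) * u1 s - x * u s" for s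
  have on: "(u has_real_derivative u1 s) (at s within A)" "(u1 has_real_derivative u2 s) (at s within A)"
    "(u2 has_real_derivative u3 s) (at s within A)" "(u3 has_real_derivative u4 s) (at s within A)"
    if "s \<in> A" "A \<subseteq> {0..1}" for s A
    using that u u1 u2 u3 DERIV_subset by blast+
  have "((\<lambda>s. green x s * u4 s) has_integral L x - L 0) {0..x}"
  proof (rule fundamental_theorem_of_calculus)
    fix s assume s: "s \<in> {0..x}"
    note d = on[OF s] green_deriv[of x s] green_deriv2[of x s]
    have g2: "green_d2 x s = s * (x - 1)" using s by (simp add: green_d2_def)
    show "(L has_vector_derivative green x s * u4 s) (at s within {0..x})"
      unfolding has_real_derivative_iff_has_vector_derivative[symmetric] L_def
      using x by (auto intro!: derivative_eq_intros d simp: g2 algebra_simps)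
  qed (use x in auto)
  moreover have "((\<lambda>s. green x s * u4 s) has_integral R 1 - R x) {x..1}"
  proof (rule fundamental_theorem_of_calculus)
    fix s assume s: "s \<in> {x..1}"
    note d = on[OF s] green_deriv[of x s] green_deriv2[of x s]
    have g2: "green_d2 x s = x * (s - 1)" using s by (simp add: green_d2_def algebra_simps)
    show "(R has_vector_derivative green x s * u4 s) (at s within {x..1})"
      unfolding has_real_derivative_iff_has_vector_derivative[symmetric] R_def
      using x by (auto intro!: derivative_eq_intros d simp: g2 algebra_simps)
  qed (use x in auto)
  ultimately have "((\<lambda>s. green x s * u4 s) has_integral (L x - L 0) + (R 1 - R x)) {0..1}"
    using x by (intro has_integral_combine[where c = x]) auto
  moreover have "L 0 = 0" "R 1 = 0"
    using x bc by (auto simp: L_def R_def green_def)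
  moreover have "L x - R x = u x" by (simp add: L_def R_def algebra_simps)
  ultimately show ?thesis unfolding green_op_def by (simp add: integral_unique)
qed

section \<open>Bounds for the integral operators\<close>

lemma integral_mult_le_SUP:
  fixes k :: "real \<Rightarrow> real \<Rightarrow> real"
  assumes k: "\<And>x. x \<in> {0..1} \<Longrightarrow> continuous_on {0..1} (k x)"
    and B: "\<And>x t. x \<in> {0..1} \<Longrightarrow> t \<in> {0..1} \<Longrightarrow> \<bar>k x t\<bar> \<le> B"
    and w: "continuous_on {0..1} w" "\<And>t. t \<in> {0..1} \<Longrightarrow> \<bar>w t\<bar> \<le> e"
    and x: "x \<in> {0..1}"
  shows "\<bar>integral {0..1} (\<lambda>t. k x t * w t)\<bar> \<le> (SUP x\<in>{0..1}. integral {0..1} (\<lambda>s. \<bar>k x s\<bar>)) * e"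
proof -
  have i: "(\<lambda>t. \<bar>k x t\<bar>) integrable_on {0..1}" if "x \<in> {0..1}" for x
    using k[OF that] by (intro integrable_continuous_interval continuous_intros)
  have bdd: "bdd_above ((\<lambda>x. integral {0..1} (\<lambda>s. \<bar>k x s\<bar>)) ` {0..1})"
  proof (rule bdd_aboveI2)
    fix x :: real assume x: "x \<in> {0..1}"
    have "integral {0..1} (\<lambda>s. \<bar>k x s\<bar>) \<le> integral {0..1} (\<lambda>s::real. B)"
      using i[OF x] B[OF x] by (intro integral_le) auto
    then show "integral {0..1} (\<lambda>s. \<bar>k x s\<bar>) \<le> B" by simp
  qed
  have e: "0 \<le> e" using w(2)[of 0] by auto
  have "norm (integral {0..1} (\<lambda>t. k x t * w t)) \<le> integral {0..1} (\<lambda>t. \<bar>k x t\<bar> * e)"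
  proof (rule integral_norm_bound_integral)
    show "(\<lambda>t. k x t * w t) integrable_on {0..1}"
      using k[OF x] w(1) by (intro integrable_continuous_interval continuous_intros)
    show "(\<lambda>t. \<bar>k x t\<bar> * e) integrable_on {0..1}" using i[OF x] by (rule integrable_on_mult_left)
    show "norm (k x t * w t) \<le> \<bar>k x t\<bar> * e" if "t \<in> {0..1}" for t
      using w(2)[OF that] by (simp add: abs_mult mult_left_mono)
  qed
  also have "\<dots> = integral {0..1} (\<lambda>t. \<bar>k x t\<bar>) * e" by simp
  also have "\<dots> \<le> (SUP x\<in>{0..1}. integral {0..1} (\<lambda>s. \<bar>k x s\<bar>)) * e"
    using e cSUP_upper[OF x bdd] by (intro mult_right_mono)
  finally show ?thesis by simp
qed

lemma green_op_bound:
  assumes "continuous_on {0..1} w" "\<And>t. t \<in> {0..1} \<Longrightarrow> \<bar>w t\<bar> \<le> e" "x \<in> {0..1}"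
  shows "\<bar>green_op w x\<bar> \<le> M0 * e"
  unfolding green_op_def M0_def
  using assms C11_on_bound[OF green_C11]
  by (intro integral_mult_le_SUP[where B = 4]) (auto intro: continuous_on_green)

lemma kernel_op_bound:
  fixes k :: "real \<times> real \<Rightarrow> real"
  assumes k: "C11_on ({0..1} \<times> {0..1}) \<kappa> k"
    and "continuous_on {0..1} w" "\<And>t. t \<in> {0..1} \<Longrightarrow> \<bar>w t\<bar> \<le> e" "x \<in> {0..1}"
  shows "\<bar>integral {0..1} (\<lambda>t. k (x, t) * w t)\<bar> \<le> kernel_bound k * e"
  unfolding kernel_bound_def
  using assms(2-) C11_on_bound[OF k] C11_on_continuous[OF C11_on_section_snd[OF k]]
  by (intro integral_mult_le_SUP[where B = \<kappa>]) auto

lemma M0_nonneg: "0 \<le> M0"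
  using green_op_bound[of "\<lambda>_. 0" 1 0] by simp

lemma green_op_diff:
  assumes "continuous_on {0..1} v" "continuous_on {0..1} w"
  shows "green_op v x - green_op w x = green_op (\<lambda>t. v t - w t) x"
  unfolding green_op_def right_diff_distrib
  by (rule integral_diff[symmetric])
    (auto intro!: integrable_continuous_interval continuous_intros continuous_on_green assms)

lemma green_op_zero [simp]: "green_op (\<lambda>_. 0) x = 0"
  by (simp add: green_op_def)

section \<open>The domain of the nonlinearity\<close>

text \<open>
  The point at which the equation and both iterations evaluate \<open>f\<close> for a given function \<open>u\<close>.
\<close>

definition f_args ::
    "(real \<times> real \<Rightarrow> real) \<Rightarrow> (real \<times> real \<Rightarrow> real) \<Rightarrow> (real \<Rightarrow> real) \<Rightarrow> (real \<Rightarrow> real) \<Rightarrow> real \<Rightarrow>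
     real \<times> real \<times> real \<times> real \<times> real" where
  "f_args k0 k1 \<phi> u x = (x, u x, u (\<phi> x), integral {0..1} (\<lambda>t. k0 (x, t) * u t),
     integral {0..1} (\<lambda>t. k1 (x, t) * u (\<phi> t)))"

lemma psi_0_eq: "psi f k0 k1 \<phi> 0 x = f (f_args k0 k1 \<phi> (\<lambda>_. 0) x)"
  by (simp add: f_args_def)

lemma psi_Suc_eq: "psi f k0 k1 \<phi> (Suc m) x = f (f_args k0 k1 \<phi> (green_op (psi f k0 k1 \<phi> m)) x)"
  by (simp add: f_args_def Let_def)

text \<open>
  The domain \<open>dom_M\<close> enlarged by \<open>\<delta>\<close> in every direction but the first.
\<close>

definition dom_box ::
    "(real \<times> real \<Rightarrow> real) \<Rightarrow> (real \<times> real \<Rightarrow> real) \<Rightarrow> real \<Rightarrow> real \<Rightarrow> (real \<times> real \<times> real \<times> real \<times> real) set" where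
  "dom_box k0 k1 M \<delta> =
     (let A = M0 * M + \<delta>; V = M0 * kernel_bound k0 * M + \<delta>; Z = M0 * kernel_bound k1 * M + \<delta>
      in cbox (0, - A, - A, - V, - Z) (1, A, A, V, Z))"

lemma mem_dom_box:
  "(x, u, y, v, z) \<in> dom_box k0 k1 M \<delta> \<longleftrightarrow> 0 \<le> x \<and> x \<le> 1 \<and> \<bar>u\<bar> \<le> M0 * M + \<delta> \<and> \<bar>y\<bar> \<le> M0 * M + \<delta> \<and>
     \<bar>v\<bar> \<le> M0 * kernel_bound k0 * M + \<delta> \<and> \<bar>z\<bar> \<le> M0 * kernel_bound k1 * M + \<delta>"
  unfolding dom_box_def Let_def cbox_Pair_iff box_real(2)[symmetric] by auto

lemma dom_box_0: "dom_box k0 k1 M 0 = dom_M k0 k1 M"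
  by (auto simp: mem_dom_box dom_M_def)

lemma convex_dom_box: "convex (dom_box k0 k1 M \<delta>)"
  by (simp add: dom_box_def Let_def convex_box)

lemma norm_5_le: "norm (a, b, c, d, e) \<le> \<bar>a\<bar> + \<bar>b\<bar> + \<bar>c\<bar> + \<bar>d\<bar> + \<bar>e\<bar>" for a b c d e :: real
proof -
  have "norm (a, b, c, d, e) \<le> norm a + (norm b + (norm c + (norm d + norm e)))"
    by (intro order_trans[OF norm_Pair_le] add_left_mono order_refl)
  then show ?thesis by simp
qed

text \<open>
  By compactness an \<open>\<epsilon>\<close>-neighbourhood of \<open>dom_M\<close> fits into the open set where \<open>f\<close> is smooth.  Pulling
  the four enlarged coordinates back to \<open>dom_M\<close> moves a point by at most \<open>4 \<delta>\<close>, so \<open>\<delta> = \<epsilon> / 5\<close>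
  works.
\<close>

lemma C2_near_imp_C11_on_dom_box:
  assumes "C2_near (dom_M k0 k1 M) f"
    and M: "0 \<le> M0 * M" "0 \<le> M0 * kernel_bound k0 * M" "0 \<le> M0 * kernel_bound k1 * M"
  shows "\<exists>\<delta>>0. \<exists>K. C11_on (dom_box k0 k1 M \<delta>) K f"
proof -
  obtain W where W: "open W" "dom_M k0 k1 M \<subseteq> W" and C2: "Ck_on 2 (W \<inter> ({0..1} \<times> UNIV)) f"
    using assms(1) unfolding C2_near_def by blast
  have "compact (dom_M k0 k1 M)"
    unfolding dom_box_0[symmetric] dom_box_def Let_def by (rule compact_cbox)
  then obtain \<epsilon> where \<epsilon>: "\<epsilon> > 0" "(\<Union>x\<in>dom_M k0 k1 M. ball x \<epsilon>) \<subseteq> W"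
    using compact_subset_open_imp_ball_epsilon_subset W by metis
  define \<delta> where "\<delta> = \<epsilon> / 5"
  have \<delta>: "\<delta> > 0" using \<epsilon> by (simp add: \<delta>_def)
  have "dom_box k0 k1 M \<delta> \<subseteq> W \<inter> ({0..1} \<times> UNIV)"
  proof
    fix p assume p: "p \<in> dom_box k0 k1 M \<delta>"
    obtain x u y v z where p_eq: "p = (x, u, y, v, z)" by (cases p) auto
    have clamp: "\<exists>s'. \<bar>s'\<bar> \<le> S \<and> \<bar>s' - s\<bar> \<le> \<delta>" if "\<bar>s\<bar> \<le> S + \<delta>" "0 \<le> S" for s S :: real
      using that \<delta> by (intro exI[of _ "max (- S) (min S s)"]) auto
    from p obtain u' y' v' z' where c:
      "\<bar>u'\<bar> \<le> M0 * M" "\<bar>u' - u\<bar> \<le> \<delta>" "\<bar>y'\<bar> \<le> M0 * M" "\<bar>y' - y\<bar> \<le> \<delta>"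
      "\<bar>v'\<bar> \<le> M0 * kernel_bound k0 * M" "\<bar>v' - v\<bar> \<le> \<delta>"
      "\<bar>z'\<bar> \<le> M0 * kernel_bound k1 * M" "\<bar>z' - z\<bar> \<le> \<delta>"
      unfolding p_eq mem_dom_box using clamp M by metis
    have x: "0 \<le> x" "x \<le> 1" using p unfolding p_eq mem_dom_box by auto
    have "dist (x, u', y', v', z') p \<le> \<bar>x - x\<bar> + \<bar>u' - u\<bar> + \<bar>y' - y\<bar> + \<bar>v' - v\<bar> + \<bar>z' - z\<bar>"
      unfolding dist_norm p_eq diff_Pair by (rule norm_5_le)
    also have "\<dots> < \<epsilon>" using c \<epsilon>(1) unfolding \<delta>_def by linarith
    finally have "p \<in> ball (x, u', y', v', z') \<epsilon>" by simp
    moreover have "(x, u', y', v', z') \<in> dom_M k0 k1 M" using c x by (simp add: dom_M_def)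
    ultimately have "p \<in> W" using \<epsilon>(2) by blast
    then show "p \<in> W \<inter> ({0..1} \<times> UNIV)" using x by (simp add: p_eq)
  qed
  with C2 have "Ck_on 2 (dom_box k0 k1 M \<delta>) f" by (rule Ck_on_subset)
  then have "\<exists>K. C11_on (dom_box k0 k1 M \<delta>) K f"
    unfolding dom_box_def Let_def by (rule Ck_on_2_imp_C11_on)
  with \<delta> show ?thesis by blast
qed

section \<open>Regularity of the iterates and the discretisation error\<close>

text \<open>
  The parameters \<open>\<kappa>\<close>, \<open>L\<close> and \<open>\<delta>\<close> are the constants that the smoothness hypotheses on
  \<open>\<phi>\<close>, the kernels and \<open>f\<close> provide.
\<close>

locale iteration_data =
  fixes f :: "real \<times> real \<times> real \<times> real \<times> real \<Rightarrow> real"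
    and k0 k1 :: "real \<times> real \<Rightarrow> real" and \<phi> :: "real \<Rightarrow> real" and M \<kappa> L \<delta> :: real
  assumes phi_maps: "x \<in> {0..1} \<Longrightarrow> \<phi> x \<in> {0..1}"
    and phi_C11: "C11_on {0..1} \<kappa> \<phi>"
    and k0_C11: "C11_on ({0..1} \<times> {0..1}) \<kappa> k0"
    and k1_C11: "C11_on ({0..1} \<times> {0..1}) \<kappa> k1"
    and f_bound: "p \<in> dom_M k0 k1 M \<Longrightarrow> \<bar>f p\<bar> \<le> M"
    and f_C11: "C11_on (dom_box k0 k1 M \<delta>) L f"
    and delta_pos: "\<delta> > 0"
    and M_nonneg: "0 \<le> M"
begin

lemma phi_cont: "continuous_on {0..1} \<phi>"
  using C11_on_continuous[OF phi_C11] .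

lemma continuous_on_compose_phi:
  assumes "continuous_on {0..1} w"
  shows "continuous_on {0..1} (\<lambda>t. w (\<phi> t))"
  using continuous_on_compose2[OF assms phi_cont] phi_maps by blast

lemma f_args_in_dom:
  assumes w: "continuous_on {0..1} w" "\<And>t. t \<in> {0..1} \<Longrightarrow> \<bar>w t\<bar> \<le> M0 * M" and x: "x \<in> {0..1}"
  shows "f_args k0 k1 \<phi> w x \<in> dom_M k0 k1 M"
  using w x phi_maps kernel_op_bound[OF k0_C11 w x]
    kernel_op_bound[OF k1_C11 continuous_on_compose_phi[OF w(1)] w(2)[OF phi_maps] x]
  by (auto simp: f_args_def dom_M_def mult_ac)

lemma dom_M_subset: "dom_M k0 k1 M \<subseteq> dom_box k0 k1 M \<delta>"
  unfolding dom_box_0[symmetric] using delta_pos by (auto simp: mem_dom_box)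

lemma kernel_op_C11:
  fixes k :: "real \<times> real \<Rightarrow> real" and w :: "real \<Rightarrow> real"
  assumes k: "C11_on ({0..1} \<times> {0..1}) \<kappa> k" and w: "C11_on {0..1} C w"
  shows "C11_on {0..1} (\<kappa> * C) (\<lambda>x. integral {0..1} (\<lambda>t. k (x, t) * w t))"
proof (rule C11_on_integral[where k = "\<lambda>x t. k (x, t) * w t"])
  show "C11_on {0..1} (\<kappa> * C) (\<lambda>x. k (x, t) * w t)" if "t \<in> {0..1}" for t
    using C11_on_mult_const[OF C11_on_section_fst[OF k that]] C11_on_bound[OF w that] by simp
  show "(\<lambda>t. k (x, t) * w t) integrable_on {0..1}" if "x \<in> {0..1}" for x
    using C11_on_continuous[OF w] C11_on_continuous[OF C11_on_section_snd[OF k that]]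
    by (intro integrable_continuous_interval continuous_intros)
qed simp

lemma compose_phi_C11:
  assumes "C11_on {0..1} C w"
  shows "C11_on {0..1} (C + C * \<kappa> + C * \<kappa>\<^sup>2) (\<lambda>t. w (\<phi> t))"
  using C11_on_compose[OF phi_C11 assms] phi_maps by (simp add: image_subset_iff)

lemma f_f_args_C11:
  assumes w: "C11_on {0..1} C w" "\<And>t. t \<in> {0..1} \<Longrightarrow> \<bar>w t\<bar> \<le> M0 * M"
  shows "\<exists>K. C11_on {0..1} K (\<lambda>x. f (f_args k0 k1 \<phi> w x))"
proof -
  have "\<exists>K. C11_on {0..1} K (f_args k0 k1 \<phi> w)"
    unfolding f_args_def[abs_def]
    using C11_on_Pair[OF C11_on_ident_unit C11_on_Pair[OF w(1) C11_on_Pair[OF compose_phi_C11[OF w(1)]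
      C11_on_Pair[OF kernel_op_C11[OF k0_C11 w(1)] kernel_op_C11[OF k1_C11 compose_phi_C11[OF w(1)]]]]]]
    by blast
  then obtain K where K: "C11_on {0..1} K (f_args k0 k1 \<phi> w)" by blast
  have "f_args k0 k1 \<phi> w ` {0..1} \<subseteq> dom_box k0 k1 M \<delta>"
    using f_args_in_dom[OF C11_on_continuous[OF w(1)] w(2)] dom_M_subset by blast
  from C11_on_compose[OF K f_C11 this _ convex_dom_box] show ?thesis by auto
qed

text \<open>
  Both properties go through one induction: the bound by \<open>M\<close> keeps the arguments of \<open>f\<close> in \<open>dom_M\<close>, which
  is what the composition rule and the bound for the next iterate require.
\<close>

lemma psi_C11_and_bound:
  "(\<exists>K. C11_on {0..1} K (psi f k0 k1 \<phi> m)) \<and> (\<forall>x\<in>{0..1}. \<bar>psi f k0 k1 \<phi> m x\<bar> \<le> M)"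
proof (induction m)
  case 0
  have z: "C11_on {0..1} 0 (\<lambda>_::real. 0::real)" using C11_on_const[of _ "0::real"] by simp
  have b: "0 \<le> M0 * M" using M0_nonneg M_nonneg by simp
  show ?case
    unfolding psi_0_eq[abs_def]
  proof (intro conjI ballI)
    show "\<exists>K. C11_on {0..1} K (\<lambda>x. f (f_args k0 k1 \<phi> (\<lambda>_. 0) x))"
      by (rule f_f_args_C11[OF z]) (simp add: b)
    show "\<bar>f (f_args k0 k1 \<phi> (\<lambda>_. 0) x)\<bar> \<le> M" if "x \<in> {0..1}" for x
      by (rule f_bound, rule f_args_in_dom) (use that b in auto)
  qed
next
  case (Suc m)
  then obtain K where K: "C11_on {0..1} K (psi f k0 k1 \<phi> m)"
    and M: "\<And>t. t \<in> {0..1} \<Longrightarrow> \<bar>psi f k0 k1 \<phi> m t\<bar> \<le> M" by blast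
  note z = green_op_C11[OF C11_on_continuous[OF K] M]
  note b = green_op_bound[OF C11_on_continuous[OF K] M]
  show ?case
    unfolding psi_Suc_eq[abs_def]
    using f_f_args_C11[OF z b] f_bound[OF f_args_in_dom[OF C11_on_continuous[OF z] b]] by blast
qed

lemma psi_cont: "continuous_on {0..1} (psi f k0 k1 \<phi> m)"
  using psi_C11_and_bound C11_on_continuous by blast

lemma psi_bound: "x \<in> {0..1} \<Longrightarrow> \<bar>psi f k0 k1 \<phi> m x\<bar> \<le> M"
  using psi_C11_and_bound by blast

lemma green_op_psi_C11: "C11_on {0..1} (4 * M) (green_op (psi f k0 k1 \<phi> m))"
  using green_op_C11[OF psi_cont psi_bound] .

lemma green_op_psi_bound: "x \<in> {0..1} \<Longrightarrow> \<bar>green_op (psi f k0 k1 \<phi> m) x\<bar> \<le> M0 * M"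
  using green_op_bound[OF psi_cont psi_bound] .

end

lemma green_disc_error:
  assumes "C11_on {0..1} K \<psi>" "1 \<le> N" "x \<in> {0..1}"
    and "\<And>j. j \<le> N \<Longrightarrow> \<bar>\<Psi> j - \<psi> (node N j)\<bar> \<le> C * (1 / real N)\<^sup>2"
  shows "\<bar>green_disc N \<Psi> x - green_op \<psi> x\<bar> \<le> (4 * C + 12 * K) * (1 / real N)\<^sup>2"
  using trapezoid_error_perturbed[OF green_C11[OF assms(3)] assms(1,2,4)]
  by (simp add: green_disc_def green_op_def)

context iteration_data
begin

text \<open>
  In the induction step all four computed arguments of \<open>f\<close> are within \<open>E h\<^sup>2\<close> of the exact ones, which
  lie in \<open>dom_M\<close>.  As soon as \<open>E h\<^sup>2 < \<delta>\<close> the computed arguments lie in the enlarged box, where \<open>f\<close> is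
  Lipschitz.
\<close>

lemma Psi_disc_error:
  "\<exists>C. \<forall>\<^sub>F N in sequentially. \<forall>i\<le>N.
     \<bar>Psi_disc f k0 k1 \<phi> N m i - psi f k0 k1 \<phi> m (node N i)\<bar> \<le> C * (1 / real N)\<^sup>2"
proof (induction m)
  case 0
  show ?case by (rule exI[of _ 0]) simp
next
  case (Suc m)
  let ?psi = "psi f k0 k1 \<phi> m" and ?Psi = "\<lambda>N. Psi_disc f k0 k1 \<phi> N m"
  let ?u = "green_op ?psi"
  obtain C where C: "\<forall>\<^sub>F N in sequentially. \<forall>i\<le>N. \<bar>?Psi N i - ?psi (node N i)\<bar> \<le> C * (1 / real N)\<^sup>2"
    using Suc by blast
  obtain K where K: "C11_on {0..1} K ?psi" using psi_C11_and_bound by blast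
  note u_C11 = green_op_psi_C11[of m]
  define C1 where "C1 = 4 * C + 12 * K"
  define K2 where "K2 = 4 * M + 4 * M * \<kappa> + 4 * M * \<kappa>\<^sup>2"
  have y_C11: "C11_on {0..1} K2 (\<lambda>t. ?u (\<phi> t))"
    unfolding K2_def using compose_phi_C11[OF u_C11] .
  define E where "E = Max {C1, \<kappa> * C1 + 3 * \<kappa> * (4 * M), \<kappa> * C1 + 3 * \<kappa> * K2}"
  have E: "C1 \<le> E" "\<kappa> * C1 + 3 * \<kappa> * (4 * M) \<le> E" "\<kappa> * C1 + 3 * \<kappa> * K2 \<le> E"
    unfolding E_def by auto
  have "(\<lambda>N. E * (1 / real N)\<^sup>2) \<longlonglongrightarrow> E * 0\<^sup>2"
    by (intro tendsto_intros lim_1_over_n)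
  then have ev: "\<forall>\<^sub>F N in sequentially. E * (1 / real N)\<^sup>2 < \<delta>"
    using order_tendstoD(2) delta_pos by fastforce
  have "\<forall>\<^sub>F N in sequentially. \<forall>i\<le>N.
     \<bar>Psi_disc f k0 k1 \<phi> N (Suc m) i - psi f k0 k1 \<phi> (Suc m) (node N i)\<bar> \<le> (L * (4 * E)) * (1 / real N)\<^sup>2"
    using C ev eventually_ge_at_top[of 1]
  proof eventually_elim
    case (elim N)
    define H where "H = (1 / real N)\<^sup>2"
    have H: "0 \<le> H" by (simp add: H_def)
    have node: "node N i \<in> {0..1}" if "i \<le> N" for i using that elim by (simp add: node_def)
    have g: "\<bar>green_disc N (?Psi N) x - ?u x\<bar> \<le> C1 * H" if "x \<in> {0..1}" for x
      unfolding C1_def H_def using elim(1) by (intro green_disc_error[OF K elim(3) that]) auto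
    show ?case
    proof (intro allI impI)
      fix i assume i: "i \<le> N"
      define U where "U j = green_disc N (?Psi N) (node N j)" for j
      define Y where "Y j = green_disc N (?Psi N) (\<phi> (node N j))" for j
      define V where "V = trap_sum N (\<lambda>j. k0 (node N i, node N j) * U j)"
      define Z where "Z = trap_sum N (\<lambda>j. k1 (node N i, node N j) * Y j)"
      define v where "v = integral {0..1} (\<lambda>t. k0 (node N i, t) * ?u t)"
      define z where "z = integral {0..1} (\<lambda>t. k1 (node N i, t) * ?u (\<phi> t))"
      have Uj: "\<bar>U j - ?u (node N j)\<bar> \<le> C1 * (1 / real N)\<^sup>2" if "j \<le> N" for j
        using g[OF node[OF that]] unfolding U_def H_def .
      have Yj: "\<bar>Y j - ?u (\<phi> (node N j))\<bar> \<le> C1 * (1 / real N)\<^sup>2" if "j \<le> N" for j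
        using g[OF phi_maps[OF node[OF that]]] unfolding Y_def H_def .
      have "\<bar>V - v\<bar> \<le> (\<kappa> * C1 + 3 * \<kappa> * (4 * M)) * H"
        unfolding V_def v_def H_def
        using trapezoid_error_perturbed[OF C11_on_section_snd[OF k0_C11 node[OF i]] u_C11 elim(3) Uj] .
      moreover have "\<bar>Z - z\<bar> \<le> (\<kappa> * C1 + 3 * \<kappa> * K2) * H"
        unfolding Z_def z_def H_def
        using trapezoid_error_perturbed[OF C11_on_section_snd[OF k1_C11 node[OF i]] y_C11 elim(3) Yj] .
      moreover note Uj[OF i] Yj[OF i]
      ultimately have err: "\<bar>U i - ?u (node N i)\<bar> \<le> E * H" "\<bar>Y i - ?u (\<phi> (node N i))\<bar> \<le> E * H"
        "\<bar>V - v\<bar> \<le> E * H" "\<bar>Z - z\<bar> \<le> E * H"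
        unfolding H_def[symmetric] using E[THEN mult_right_mono, OF H] by linarith+
      define p where "p = (node N i, ?u (node N i), ?u (\<phi> (node N i)), v, z)"
      define P where "P = (node N i, U i, Y i, V, Z)"
      have p_eq: "p = f_args k0 k1 \<phi> ?u (node N i)" by (simp add: p_def f_args_def v_def z_def)
      have p: "p \<in> dom_M k0 k1 M"
        unfolding p_eq using f_args_in_dom[OF C11_on_continuous[OF u_C11] green_op_psi_bound node[OF i]] .
      have "E * H < \<delta>" using elim(2) by (simp add: H_def)
      then have grow: "\<bar>b\<bar> \<le> S + \<delta>" if "\<bar>a\<bar> \<le> S + 0" "\<bar>b - a\<bar> \<le> E * H" for a b S
        using that by linarith
      have P: "P \<in> dom_box k0 k1 M \<delta>"
        using p unfolding P_def p_def dom_box_0[symmetric] mem_dom_box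
        by (blast intro: grow[OF _ err(1)] grow[OF _ err(2)] grow[OF _ err(3)] grow[OF _ err(4)])
      have "norm (P - p) \<le> \<bar>node N i - node N i\<bar> + \<bar>U i - ?u (node N i)\<bar> + \<bar>Y i - ?u (\<phi> (node N i))\<bar>
          + \<bar>V - v\<bar> + \<bar>Z - z\<bar>"
        unfolding P_def p_def diff_Pair by (rule norm_5_le)
      then have "norm (P - p) \<le> 4 * (E * H)" using err by linarith
      then have "L * norm (P - p) \<le> L * (4 * (E * H))"
        using C11_on_nonneg[OF f_C11] P by (intro mult_left_mono) auto
      moreover have "\<bar>f P - f p\<bar> \<le> L * norm (P - p)"
        using C11_on_lipschitz[OF f_C11 P subsetD[OF dom_M_subset p]] by simp
      moreover have "Psi_disc f k0 k1 \<phi> N (Suc m) i = f P"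
        by (simp add: P_def U_def[abs_def] Y_def[abs_def] V_def Z_def Let_def)
      ultimately show "\<bar>Psi_disc f k0 k1 \<phi> N (Suc m) i - psi f k0 k1 \<phi> (Suc m) (node N i)\<bar>
          \<le> (L * (4 * E)) * (1 / real N)\<^sup>2"
        unfolding psi_Suc_eq p_eq[symmetric] by (simp add: H_def mult_ac)
    qed
  qed
  then show ?case by blast
qed

lemma U_disc_error:
  "\<exists>C. \<forall>\<^sub>F N in sequentially. \<forall>i\<le>N.
     \<bar>U_disc f k0 k1 \<phi> N m i - green_op (psi f k0 k1 \<phi> m) (node N i)\<bar> \<le> C * (1 / real N)\<^sup>2"
proof -
  obtain C where C: "\<forall>\<^sub>F N in sequentially. \<forall>i\<le>N.
      \<bar>Psi_disc f k0 k1 \<phi> N m i - psi f k0 k1 \<phi> m (node N i)\<bar> \<le> C * (1 / real N)\<^sup>2"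
    using Psi_disc_error by blast
  obtain K where K: "C11_on {0..1} K (psi f k0 k1 \<phi> m)" using psi_C11_and_bound by blast
  have "\<forall>\<^sub>F N in sequentially. \<forall>i\<le>N.
     \<bar>U_disc f k0 k1 \<phi> N m i - green_op (psi f k0 k1 \<phi> m) (node N i)\<bar> \<le> (4 * C + 12 * K) * (1 / real N)\<^sup>2"
    using C eventually_ge_at_top[of 1]
  proof eventually_elim
    case (elim N)
    show ?case
      unfolding U_disc_def
    proof (intro allI impI)
      fix i assume "i \<le> N"
      then have x: "node N i \<in> {0..1}" using elim(2) by (simp add: node_def)
      show "\<bar>green_disc N (Psi_disc f k0 k1 \<phi> N m) (node N i) - green_op (psi f k0 k1 \<phi> m) (node N i)\<bar>
          \<le> (4 * C + 12 * K) * (1 / real N)\<^sup>2"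
        by (rule green_disc_error[OF K elim(2) x]) (use elim(1) in blast)
    qed
  qed
  then show ?thesis by blast
qed

end

section \<open>Convergence of the continuous iteration\<close>

locale contractive_iteration = iteration_data +
  fixes L0 L1 L2 L3 q :: real and u u4 :: "real \<Rightarrow> real"
  assumes L_nonneg: "L0 \<ge> 0" "L1 \<ge> 0" "L2 \<ge> 0" "L3 \<ge> 0"
    and f_lipschitz: "(x, u1, y1, v1, z1) \<in> dom_M k0 k1 M \<Longrightarrow> (x, u2, y2, v2, z2) \<in> dom_M k0 k1 M \<Longrightarrow>
          \<bar>f (x, u2, y2, v2, z2) - f (x, u1, y1, v1, z1)\<bar>
            \<le> L0 * \<bar>u2 - u1\<bar> + L1 * \<bar>y2 - y1\<bar> + L2 * \<bar>v2 - v1\<bar> + L3 * \<bar>z2 - z1\<bar>"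
    and q_eq: "q = (L0 + L1 + L2 * kernel_bound k0 + L3 * kernel_bound k1) * M0"
    and q_less: "q < 1"
    and u4_cont: "continuous_on {0..1} u4"
    and u_green: "x \<in> {0..1} \<Longrightarrow> green_op u4 x = u x"
    and u_cont: "continuous_on {0..1} u"
    and u_bound: "x \<in> {0..1} \<Longrightarrow> \<bar>u x\<bar> \<le> M0 * M"
    and u4_eq: "x \<in> {0..1} \<Longrightarrow> u4 x = f (f_args k0 k1 \<phi> u x)"
begin

lemma green_op_error:
  assumes "\<And>x. x \<in> {0..1} \<Longrightarrow> \<bar>psi f k0 k1 \<phi> m x - u4 x\<bar> \<le> e" and x: "x \<in> {0..1}"
  shows "\<bar>green_op (psi f k0 k1 \<phi> m) x - u x\<bar> \<le> M0 * e"
  unfolding u_green[OF x, symmetric] green_op_diff[OF psi_cont u4_cont]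
  using assms psi_cont u4_cont by (intro green_op_bound continuous_intros)

lemma psi_Suc_error:
  assumes e: "\<And>x. x \<in> {0..1} \<Longrightarrow> \<bar>psi f k0 k1 \<phi> m x - u4 x\<bar> \<le> e" and x: "x \<in> {0..1}"
  shows "\<bar>psi f k0 k1 \<phi> (Suc m) x - u4 x\<bar> \<le> q * e"
proof -
  let ?u = "green_op (psi f k0 k1 \<phi> m)"
  note w_cont = C11_on_continuous[OF green_op_psi_C11[of m]]
  have err: "\<bar>?u t - u t\<bar> \<le> M0 * e" if "t \<in> {0..1}" for t using green_op_error[OF e that] by simp
  have dv: "\<bar>integral {0..1} (\<lambda>t. k (x, t) * v t) - integral {0..1} (\<lambda>t. k (x, t) * w t)\<bar> \<le> kernel_bound k * (M0 * e)"
    if k: "C11_on ({0..1} \<times> {0..1}) \<kappa> k" and v: "continuous_on {0..1} v" and w: "continuous_on {0..1} w"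
      and vw: "\<And>t. t \<in> {0..1} \<Longrightarrow> \<bar>v t - w t\<bar> \<le> M0 * e" for k v w
  proof -
    have "integral {0..1} (\<lambda>t. k (x, t) * v t) - integral {0..1} (\<lambda>t. k (x, t) * w t)
        = integral {0..1} (\<lambda>t. k (x, t) * (v t - w t))"
      unfolding right_diff_distrib using C11_on_continuous[OF C11_on_section_snd[OF k x]] v w
      by (intro integral_diff[symmetric] integrable_continuous_interval continuous_intros)
    then show ?thesis
      using kernel_op_bound[OF k continuous_on_diff[OF v w] vw x] by simp
  qed
  have "\<bar>f (f_args k0 k1 \<phi> ?u x) - f (f_args k0 k1 \<phi> u x)\<bar>
      \<le> L0 * (M0 * e) + L1 * (M0 * e) + L2 * (kernel_bound k0 * (M0 * e)) + L3 * (kernel_bound k1 * (M0 * e))"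
    unfolding f_args_def
  proof (rule order_trans[OF f_lipschitz])
    show "(x, u x, u (\<phi> x), integral {0..1} (\<lambda>t. k0 (x, t) * u t), integral {0..1} (\<lambda>t. k1 (x, t) * u (\<phi> t)))
        \<in> dom_M k0 k1 M"
      using f_args_in_dom[OF u_cont u_bound x] by (simp add: f_args_def)
    show "(x, ?u x, ?u (\<phi> x), integral {0..1} (\<lambda>t. k0 (x, t) * ?u t), integral {0..1} (\<lambda>t. k1 (x, t) * ?u (\<phi> t)))
        \<in> dom_M k0 k1 M"
      using f_args_in_dom[OF w_cont green_op_psi_bound x] by (simp add: f_args_def)
  qed (intro add_mono mult_left_mono L_nonneg err dv k0_C11 k1_C11 phi_maps x w_cont u_cont
      continuous_on_compose_phi; simp)
  also have "\<dots> = q * e" unfolding q_eq by (simp add: algebra_simps)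
  finally show ?thesis unfolding psi_Suc_eq u4_eq[OF x] .
qed

text \<open>
  The initial error \<open>e = \<parallel>\<psi>\<^sub>0 - u4\<parallel>\<close> is attained at some \<open>x0\<close>.  Comparing through \<open>\<psi>\<^sub>1\<close> gives
  \<open>e \<le> d + q e\<close>, hence \<open>e \<le> d / (1 - q)\<close>; each iteration multiplies the bound by \<open>q\<close>.
\<close>

lemma psi_error:
  defines "d \<equiv> SUP x\<in>{0..1}. \<bar>psi f k0 k1 \<phi> 1 x - psi f k0 k1 \<phi> 0 x\<bar>"
  assumes "x \<in> {0..1}"
  shows "\<bar>psi f k0 k1 \<phi> m x - u4 x\<bar> \<le> q ^ m / (1 - q) * d"
  using assms(2)
proof (induction m arbitrary: x)
  case 0
  have "continuous_on {0..1} (\<lambda>x. \<bar>psi f k0 k1 \<phi> 0 x - u4 x\<bar>)"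
    using psi_cont u4_cont by (intro continuous_intros)
  then obtain x0 where x0: "x0 \<in> {0..1}"
    and max: "\<And>x. x \<in> {0..1} \<Longrightarrow> \<bar>psi f k0 k1 \<phi> 0 x - u4 x\<bar> \<le> \<bar>psi f k0 k1 \<phi> 0 x0 - u4 x0\<bar>"
    using continuous_attains_sup[of "{0..1::real}" "\<lambda>x. \<bar>psi f k0 k1 \<phi> 0 x - u4 x\<bar>"] by auto
  define e where "e = \<bar>psi f k0 k1 \<phi> 0 x0 - u4 x0\<bar>"
  have "\<bar>psi f k0 k1 \<phi> 1 x - psi f k0 k1 \<phi> 0 x\<bar> \<le> 2 * M" if "x \<in> {0..1}" for x
    using psi_bound[OF that, of 0] psi_bound[OF that, of 1] by linarith
  then have bdd: "bdd_above ((\<lambda>x. \<bar>psi f k0 k1 \<phi> 1 x - psi f k0 k1 \<phi> 0 x\<bar>) ` {0..1})"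
    by (rule bdd_aboveI2)
  have "\<bar>psi f k0 k1 \<phi> 1 x0 - psi f k0 k1 \<phi> 0 x0\<bar> \<le> d"
    unfolding d_def by (rule cSUP_upper[OF x0 bdd])
  moreover have "\<bar>psi f k0 k1 \<phi> 1 x0 - u4 x0\<bar> \<le> q * e"
    using psi_Suc_error[of 0 e x0] max x0 by (simp add: e_def)
  ultimately have "e \<le> d + q * e" unfolding e_def by linarith
  then have "e \<le> d / (1 - q)" using q_less by (simp add: pos_le_divide_eq algebra_simps)
  with max[OF 0] show ?case by (simp add: e_def)
next
  case (Suc m)
  from psi_Suc_error[OF Suc.IH Suc.prems] show ?case by simp
qed

lemma continuous_iteration_error:
  assumes "x \<in> {0..1}"
  shows "\<bar>green_op (psi f k0 k1 \<phi> m) x - u x\<bar>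
    \<le> M0 * (q ^ m / (1 - q)) * (SUP x\<in>{0..1}. \<bar>psi f k0 k1 \<phi> 1 x - psi f k0 k1 \<phi> 0 x\<bar>)"
  using green_op_error[OF psi_error assms] by (simp add: mult.assoc)

end

section \<open>The total error\<close>

lemma grid_norm_le:
  assumes "\<And>i. i \<le> N \<Longrightarrow> \<bar>w i\<bar> \<le> B"
  shows "grid_norm N w \<le> B"
  unfolding grid_norm_def using assms by (subst Max_le_iff) auto

theorem theorem3p5:
  fixes f :: "real \<times> real \<times> real \<times> real \<times> real \<Rightarrow> real"
    and k0 k1 :: "real \<times> real \<Rightarrow> real"
    and \<phi> u :: "real \<Rightarrow> real"
    and M L0 L1 L2 L3 q d :: real
  assumes f_cont: "continuous_on ({0..1} \<times> UNIV) f"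
    and k0_cont: "continuous_on ({0..1} \<times> {0..1}) k0"
    and k1_cont: "continuous_on ({0..1} \<times> {0..1}) k1"
    and phi_cont: "continuous_on {0..1} \<phi>"
    and phi_maps: "\<phi> ` {0..1} \<subseteq> {0..1}"
    and M_pos: "M > 0"
    and L_nonneg: "L0 \<ge> 0" "L1 \<ge> 0" "L2 \<ge> 0" "L3 \<ge> 0"
    and f_cont_D: "continuous_on (dom_M k0 k1 M) f"
    and f_bound: "\<And>p. p \<in> dom_M k0 k1 M \<Longrightarrow> \<bar>f p\<bar> \<le> M"
    and f_lipschitz: "\<And>x u1 y1 v1 z1 u2 y2 v2 z2.
          (x, u1, y1, v1, z1) \<in> dom_M k0 k1 M \<Longrightarrow> (x, u2, y2, v2, z2) \<in> dom_M k0 k1 M \<Longrightarrow>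
          \<bar>f (x, u2, y2, v2, z2) - f (x, u1, y1, v1, z1)\<bar>
            \<le> L0 * \<bar>u2 - u1\<bar> + L1 * \<bar>y2 - y1\<bar> + L2 * \<bar>v2 - v1\<bar> + L3 * \<bar>z2 - z1\<bar>"
    and q_eq: "q = (L0 + L1 + L2 * kernel_bound k0 + L3 * kernel_bound k1) * M0"
    and q_less: "q < 1"
    and f_C2: "C2_near (dom_M k0 k1 M) f"
    and k0_C2: "Ck_on 2 ({0..1} \<times> {0..1}) k0"
    and k1_C2: "Ck_on 2 ({0..1} \<times> {0..1}) k1"
    and phi_C2: "Ck_on 2 {0..1} \<phi>"
    and u_sol: "bvp_solution f k0 k1 \<phi> u"
    and u_bound: "\<And>x. x \<in> {0..1} \<Longrightarrow> \<bar>u x\<bar> \<le> M0 * M"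
    and d_eq: "d = (SUP x\<in>{0..1}. \<bar>psi f k0 k1 \<phi> 1 x - psi f k0 k1 \<phi> 0 x\<bar>)"
  shows "\<forall>m. \<exists>R :: nat \<Rightarrow> real. R \<in> O(\<lambda>N. (1 / real N)^2) \<and>
           (\<forall>N\<ge>1. grid_norm N (\<lambda>i. U_disc f k0 k1 \<phi> N m i - u (node N i))
                     \<le> M0 * (q^m / (1 - q)) * d + R N)"
proof
  fix m
  obtain u1 u2 u3 u4 where
    u1: "\<And>x. x \<in> {0..1} \<Longrightarrow> (u has_real_derivative u1 x) (at x within {0..1})" and
    u2: "\<And>x. x \<in> {0..1} \<Longrightarrow> (u1 has_real_derivative u2 x) (at x within {0..1})" and
    u3: "\<And>x. x \<in> {0..1} \<Longrightarrow> (u2 has_real_derivative u3 x) (at x within {0..1})" and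
    u4: "\<And>x. x \<in> {0..1} \<Longrightarrow> (u3 has_real_derivative u4 x) (at x within {0..1})" and
    u4_cont: "continuous_on {0..1} u4" and
    u4_eq: "\<And>x. x \<in> {0..1} \<Longrightarrow> u4 x = f (f_args k0 k1 \<phi> u x)" and
    bc: "u 0 = 0" "u 1 = 0" "u2 0 = 0" "u2 1 = 0"
    using u_sol unfolding bvp_solution_def f_args_def by blast
  have square: "{0..1} \<times> {0..1} = cbox (0, 0) (1::real, 1::real)"
    by (simp only: cbox_Pair_eq box_real)
  obtain \<kappa>0 where \<kappa>0: "C11_on ({0..1} \<times> {0..1}) \<kappa>0 k0"
    using Ck_on_2_imp_C11_on k0_C2 unfolding square by blast
  obtain \<kappa>1 where \<kappa>1: "C11_on ({0..1} \<times> {0..1}) \<kappa>1 k1"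
    using Ck_on_2_imp_C11_on k1_C2 unfolding square by blast
  obtain \<kappa>2 where \<kappa>2: "C11_on {0..1} \<kappa>2 \<phi>"
    using Ck_on_2_imp_C11_on phi_C2 unfolding cbox_interval[symmetric] by blast
  define \<kappa> where "\<kappa> = max \<kappa>0 (max \<kappa>1 \<kappa>2)"
  have \<kappa>: "C11_on ({0..1} \<times> {0..1}) \<kappa> k0" "C11_on ({0..1} \<times> {0..1}) \<kappa> k1" "C11_on {0..1} \<kappa> \<phi>"
    using \<kappa>0 \<kappa>1 \<kappa>2 by (auto intro: C11_on_mono simp: \<kappa>_def)
  have kb: "0 \<le> kernel_bound k" if k: "C11_on ({0..1} \<times> {0..1}) \<kappa> k" for k
    using kernel_op_bound[OF k, of "\<lambda>_. 0" 1 0] by simp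
  obtain \<delta> L where \<delta>: "\<delta> > 0" "C11_on (dom_box k0 k1 M \<delta>) L f"
    using C2_near_imp_C11_on_dom_box[OF f_C2] M0_nonneg kb \<kappa> M_pos by force
  have phi_in: "\<phi> x \<in> {0..1}" if "x \<in> {0..1}" for x
    using phi_maps that by blast
  interpret contractive_iteration f k0 k1 \<phi> M \<kappa> L \<delta> L0 L1 L2 L3 q u u4
    using phi_in \<kappa> f_bound \<delta> M_pos L_nonneg f_lipschitz q_eq q_less u4_cont u_bound u4_eq
      green_representation[OF u1 u2 u3 u4 bc] DERIV_continuous_on[OF u1]
    by unfold_locales auto
  let ?e = "\<lambda>N. grid_norm N (\<lambda>i. U_disc f k0 k1 \<phi> N m i - u (node N i))"
  let ?b = "M0 * (q ^ m / (1 - q)) * d"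
  \<comment> \<open>\<open>R\<close> is the excess over the main term: finitely many coarse grids, on which the discretisation
    estimate may fail, then do not affect its order.\<close>
  define R where "R N = max 0 (?e N - ?b)" for N
  obtain C where C: "\<forall>\<^sub>F N in sequentially. \<forall>i\<le>N.
     \<bar>U_disc f k0 k1 \<phi> N m i - green_op (psi f k0 k1 \<phi> m) (node N i)\<bar> \<le> C * (1 / real N)\<^sup>2"
    using U_disc_error by blast
  have "R \<in> O(\<lambda>N. (1 / real N)\<^sup>2)"
  proof (rule bigoI)
    show "\<forall>\<^sub>F N in sequentially. norm (R N) \<le> max 0 C * norm ((1 / real N)\<^sup>2)"
      using C eventually_ge_at_top[of 1]
    proof eventually_elim
      case (elim N)
      have "?e N \<le> ?b + C * (1 / real N)\<^sup>2"
      proof (rule grid_norm_le)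
        fix i assume i: "i \<le> N"
        then have "node N i \<in> {0..1}" using elim(2) by (simp add: node_def)
        from continuous_iteration_error[OF this, of m] elim(1) i
        show "\<bar>U_disc f k0 k1 \<phi> N m i - u (node N i)\<bar> \<le> ?b + C * (1 / real N)\<^sup>2"
          unfolding d_eq by fastforce
      qed
      moreover have "C * (1 / real N)\<^sup>2 \<le> max 0 C * (1 / real N)\<^sup>2" "0 \<le> max 0 C * (1 / real N)\<^sup>2"
        by (auto intro: mult_right_mono)
      ultimately have "R N \<le> max 0 C * (1 / real N)\<^sup>2" unfolding R_def by linarith
      then show ?case by (simp add: R_def)
    qed
  qed
  moreover have "?e N \<le> ?b + R N" for N unfolding R_def by linarith
  ultimately show "\<exists>R. R \<in> O(\<lambda>N. (1 / real N)\<^sup>2) \<and> (\<forall>N\<ge>1. ?e N \<le> ?b + R N)" by blast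
qed

end
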